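(* Let $N\ge2$, $1\le j<N$, and $\theta=2j\pi/N$. Set $F_1=1$ if $N=2$ and $F_1=(\pi-\theta)\csc\theta$ if $N\ge3$; set $F_2=1/3$ if $N=2$ and $F_2=(\cos\theta\,F_1+1)\csc^2\theta$ if $N\ge3$; and let the sequence $(F_n)_{n\ge1}$ satisfy \[ n\sin^2\theta\,F_{n+1}-(2n-1)\cos\theta\,F_n-(n-1)F_{n-1}=0\qquad\forall n\ge2. \] Then for every positive integer $l$ and every composition $\mathbf{k}$ of positive integers (possibly empty), \[ \sum_{n\ge1}\frac{H_{n-1}(\mathbf{k})}{n^l}(1-\cos\theta)^nF_n\in\mathrm{CMZV}^N_{|\mathbf{k}|+l+1}. \] In particular, with $\mu=e^{i\theta}$ and $\bar\mu$ its complex conjugate, \[ \sum_{n\ge1}\frac{(1-\cos\theta)^nF_n}{n}=2\zeta(2)-\mathrm{Li}_2(\mu)-\mathrm{Li}_2(\bar\mu)\in\mathrm{CMZV}^N_2, \] \[ \sum_{n\ge1}\frac{(1-\cos\theta)^nF_n}{n^2}=\sum_{\eta=\mu,\bar\mu}\Big(2\mathrm{Li}_{2,1}(\eta,\bar\eta)-\mathrm{Li}_{2,1}(\eta,1)-\mathrm{Li}_{2,1}(\eta,\bar\eta^2)\Big)+2\zeta(3)-\mathrm{Li}_3(\mu)-\mathrm{Li}_3(\bar\mu)\in\mathrm{CMZV}^N_3. \]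
   Context: For a composition $\mathbf{k}=(k_1,\dots,k_d)$ and an integer $M\ge0$, the multiple harmonic sum is $H_M(\mathbf{k})=\sum_{M\ge n_1>\dots>n_d>0}\frac{1}{n_1^{k_1}\cdots n_d^{k_d}}$, with $H_M(\emptyset)=1$; $|\mathbf{k}|=k_1+\dots+k_d$. For roots of unity $\eta_1,\dots,\eta_d$, $\mathrm{Li}_{\mathbf{k}}(\eta_1,\dots,\eta_d)=\sum_{n_1>\dots>n_d>0}\frac{\eta_1^{n_1}\cdots\eta_d^{n_d}}{n_1^{k_1}\cdots n_d^{k_d}}$ (convergent iff $(k_1,\eta_1)\ne(1,1)$), and $\mathrm{CMZV}^N_w$ is the $\mathbb{Q}$-linear span of all convergent such values of weight $|\mathbf{k}|=w$ with all $\eta_j$ being $N$th roots of unity. $\zeta$ is the Riemann zeta function.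
   Formalization: For even N ≥ 4 and j = N/2 we have θ = π, where csc θ is undefined; there the formal statement takes F_1 = 1 and F_2 = 1/3 (the limits of the csc formulas, and the N = 2 values), and elsewhere it uses the stated formulas. *)

theory Defs
  imports "HOL-Analysis.Analysis"
begin

text \<open>
  Compositions are lists of natural numbers; positivity of the entries is a separate predicate.
  A list \<open>[n\<^sub>1, \<dots>, n\<^sub>d]\<close> below stands for the summation indices \<open>M \<ge> n\<^sub>1 > \<dots> > n\<^sub>d > 0\<close>.
\<close>

definition composition :: "nat list \<Rightarrow> bool" where
  "composition ks \<longleftrightarrow> (\<forall>k\<in>set ks. 0 < k)"

definition decreasing_indices :: "nat \<Rightarrow> nat \<Rightarrow> nat list set" where
  "decreasing_indices d M = {ns. length ns = d \<and> sorted_wrt (>) ns \<and> set ns \<subseteq> {1..M}}"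

lemma finite_decreasing_indices: "finite (decreasing_indices d M)"
  by (rule finite_subset[OF _ finite_lists_length_eq[of "{1..M}" d]])
     (auto simp: decreasing_indices_def)

definition multiple_harmonic_sum :: "nat \<Rightarrow> nat list \<Rightarrow> real" where
  "multiple_harmonic_sum M ks =
     (\<Sum>ns\<in>decreasing_indices (length ks) M. 1 / (\<Prod>i<length ks. real (ns ! i) ^ (ks ! i)))"

lemma multiple_harmonic_sum_Nil: "multiple_harmonic_sum M [] = 1"
proof -
  have "decreasing_indices 0 M = {[]}"
    by (auto simp: decreasing_indices_def)
  then show ?thesis
    by (simp add: multiple_harmonic_sum_def)
qed

text \<open>
  The series defining \<open>Li\<close> need not converge absolutely (when \<open>k\<^sub>1 = 1\<close>), so it is summed,
  as usual, by truncating at \<open>n\<^sub>1 \<le> M\<close> and letting \<open>M\<close> tend to infinity.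
\<close>

definition Li_trunc :: "nat list \<Rightarrow> complex list \<Rightarrow> nat \<Rightarrow> complex" where
  "Li_trunc ks \<eta>s M =
     (\<Sum>ns\<in>decreasing_indices (length ks) M.
        (\<Prod>i<length ks. (\<eta>s ! i) ^ (ns ! i)) / (\<Prod>i<length ks. of_nat (ns ! i) ^ (ks ! i)))"

definition Li_convergent :: "nat list \<Rightarrow> complex list \<Rightarrow> bool" where
  "Li_convergent ks \<eta>s \<longleftrightarrow> convergent (Li_trunc ks \<eta>s)"

definition Li :: "nat list \<Rightarrow> complex list \<Rightarrow> complex" where
  "Li ks \<eta>s = lim (Li_trunc ks \<eta>s)"

abbreviation rat_scale :: "rat \<Rightarrow> complex \<Rightarrow> complex" where
  "rat_scale q z \<equiv> of_rat q * z"

lemma vector_space_rat_scale: "vector_space rat_scale"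
  by unfold_locales (simp_all add: algebra_simps of_rat_add of_rat_mult)

definition CMZV :: "nat \<Rightarrow> nat \<Rightarrow> complex set" where
  "CMZV N w = module.span rat_scale
     {Li ks \<eta>s | ks \<eta>s. composition ks \<and> sum_list ks = w \<and> length \<eta>s = length ks \<and>
        (\<forall>\<eta>\<in>set \<eta>s. \<eta> ^ N = 1) \<and> Li_convergent ks \<eta>s}"

text \<open>Only meaningful for \<open>Re s > 1\<close>, where the series represents the Riemann zeta function.\<close>

definition zeta :: "complex \<Rightarrow> complex" where
  "zeta s = (\<Sum>n. 1 / of_nat (Suc n) powr s)"

end

theory Submission
  imports Defs
begin

text \<open>
  Writing \<open>c = cos \<theta>\<close> and \<open>q x = 1 - 2 c x + x\<^sup>2 = (1 - \<mu> x) (1 - cnj \<mu> x)\<close>, the sequence is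
  \<open>F n = \<integral>\<^sub>0\<^sup>1 (2 x / q x) ^ n dx / x\<close>. Hence the series is \<open>\<integral>\<^sub>0\<^sup>1 G (u x) dx / x\<close> with
  \<open>u x = 2 (1 - c) x / q x\<close> and \<open>G\<close> a multiple polylogarithm in one variable, that is, an
  iterated integral of the forms \<open>du / u\<close> and \<open>du / (1 - u)\<close>. Pulled back along \<open>u\<close>, these become
  integral combinations of \<open>dx / x\<close> and \<open>\<eta> dx / (1 - \<eta> x)\<close> with \<open>\<eta> \<in> {1, \<mu>, cnj \<mu>}\<close>, so the
  integral is a combination of iterated integrals on \<open>[0, 1]\<close> that are convergent values of \<open>Li\<close>
  at \<open>N\<close>th roots of unity. All iterated integrals are handled through their Taylor coefficients.
\<close>

section \<open>Taylor coefficients of multiple polylogarithms and truncated sums\<close>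

text \<open>The coefficient of \<open>z ^ n\<close> in the one-variable series whose largest index
  \<open>n\<close> carries \<open>z\<close>. The empty composition stands for the constant series 1,
  hence the value 1 at \<open>n = 0\<close> only; for a nonempty one the inner sum is empty at
  \<open>n = 0\<close>, so the coefficient there is 0.\<close>

fun polylog_coeff :: "nat list \<Rightarrow> complex list \<Rightarrow> nat \<Rightarrow> complex" where
  "polylog_coeff (k # ks) (\<eta> # \<eta>s) n = \<eta> ^ n / of_nat n ^ k * (\<Sum>m<n. polylog_coeff ks \<eta>s m)"
| "polylog_coeff _ _ n = (if n = 0 then 1 else 0)"

lemma Cons_in_decreasing_indices_iff:
  "n # ns \<in> decreasing_indices (Suc d) M \<longleftrightarrow> n \<in> {1..M} \<and> ns \<in> decreasing_indices d (n - 1)"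
proof
  assume R: "n \<in> {1..M} \<and> ns \<in> decreasing_indices d (n - 1)"
  then have "m \<le> n - 1" "1 \<le> m" if "m \<in> set ns" for m
    using that by (auto simp: decreasing_indices_def)
  then have "m < n" "m \<le> M" "1 \<le> m" if "m \<in> set ns" for m
    using that R by force+
  with R show "n # ns \<in> decreasing_indices (Suc d) M"
    by (auto simp: decreasing_indices_def)
next
  assume L: "n # ns \<in> decreasing_indices (Suc d) M"
  then have "1 \<le> m" "m \<le> n - 1" if "m \<in> set ns" for m
    using that by (fastforce simp: decreasing_indices_def)+
  with L show "n \<in> {1..M} \<and> ns \<in> decreasing_indices d (n - 1)"
    by (auto simp: decreasing_indices_def)
qed

lemma decreasing_indices_Suc:
  "decreasing_indices (Suc d) M = (\<Union>n\<in>{1..M}. (#) n ` decreasing_indices d (n - 1))"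
proof (rule set_eqI)
  fix ns
  show "ns \<in> decreasing_indices (Suc d) M \<longleftrightarrow>
      ns \<in> (\<Union>n\<in>{1..M}. (#) n ` decreasing_indices d (n - 1))"
  proof (cases ns)
    case (Cons n ns')
    then show ?thesis
      unfolding Cons Cons_in_decreasing_indices_iff by blast
  qed (auto simp: decreasing_indices_def)
qed

lemma Li_trunc_Nil: "Li_trunc [] \<eta>s M = 1"
proof -
  have "decreasing_indices 0 M = {[]}"
    by (auto simp: decreasing_indices_def)
  then show ?thesis
    by (simp add: Li_trunc_def)
qed

lemma Li_trunc_Cons:
  "Li_trunc (k # ks) (\<eta> # \<eta>s) M = (\<Sum>n=1..M. \<eta> ^ n / of_nat n ^ k * Li_trunc ks \<eta>s (n - 1))"
proof -
  let ?f = "\<lambda>ks \<eta>s ns. (\<Prod>i<length ks. (\<eta>s ! i) ^ (ns ! i)) / (\<Prod>i<length ks. of_nat (ns ! i) ^ (ks ! i)) :: complex"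
  have "Li_trunc (k # ks) (\<eta> # \<eta>s) M =
      (\<Sum>n=1..M. \<Sum>ns\<in>(#) n ` decreasing_indices (length ks) (n - 1). ?f (k # ks) (\<eta> # \<eta>s) ns)"
    unfolding Li_trunc_def list.size(4) decreasing_indices_Suc add_Suc_right add_0_right
    by (subst sum.UNION_disjoint) (auto simp: finite_decreasing_indices)
  also have "\<dots> = (\<Sum>n=1..M. \<eta> ^ n / of_nat n ^ k * Li_trunc ks \<eta>s (n - 1))"
    by (simp add: sum.reindex Li_trunc_def sum_distrib_left lessThan_Suc_eq_insert_0 prod.reindex)
  finally show ?thesis .
qed

lemma Li_trunc_eq_sum_polylog_coeff:
  assumes "composition ks" "length \<eta>s = length ks"
  shows "Li_trunc ks \<eta>s M = (\<Sum>n\<le>M. polylog_coeff ks \<eta>s n)"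
  using assms(2,1)
proof (induction \<eta>s ks arbitrary: M rule: list_induct2)
  case Nil
  then show ?case by (simp add: Li_trunc_Nil)
next
  case (Cons \<eta> \<eta>s k ks)
  have "Li_trunc (k # ks) (\<eta> # \<eta>s) M = (\<Sum>n=1..M. polylog_coeff (k # ks) (\<eta> # \<eta>s) n)"
    unfolding Li_trunc_Cons
  proof (rule sum.cong)
    fix n assume "n \<in> {1..M}"
    then have "{..n - 1} = {..<n}" by auto
    with Cons show "\<eta> ^ n / of_nat n ^ k * Li_trunc ks \<eta>s (n - 1) = polylog_coeff (k # ks) (\<eta> # \<eta>s) n"
      by (simp add: composition_def)
  qed simp
  \<comment> \<open>The added index 0 contributes nothing, its inner sum being empty.\<close>
  also have "\<dots> = (\<Sum>n\<le>M. polylog_coeff (k # ks) (\<eta> # \<eta>s) n)"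
    by (rule sum.mono_neutral_left) (auto simp: not_le Suc_le_eq)
  finally show ?case .
qed

lemma of_real_multiple_harmonic_sum:
  "of_real (multiple_harmonic_sum n ks) = Li_trunc ks (replicate (length ks) 1) n"
  by (simp add: multiple_harmonic_sum_def Li_trunc_def cong: prod.cong_simp)

lemma multiple_harmonic_sum_polylog_coeff:
  assumes "composition ks"
  shows "complex_of_real (multiple_harmonic_sum n ks / real (Suc n) ^ l)
    = polylog_coeff (l # ks) (1 # replicate (length ks) 1) (Suc n)"
  using assms
  by (simp add: of_real_multiple_harmonic_sum Li_trunc_eq_sum_polylog_coeff lessThan_Suc_atMost)

text \<open>By induction the inner sum has \<open>n\<close> terms of norm at most 1, and
  \<open>n \<le> n ^ k\<close> because \<open>k > 0\<close>. The bound also covers the empty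
  composition, and it gives convergence in the open unit disc.\<close>

lemma norm_polylog_coeff_le_one:
  assumes "composition ks" "\<forall>\<eta>\<in>set \<eta>s. norm \<eta> = 1"
  shows "norm (polylog_coeff ks \<eta>s n) \<le> 1"
  using assms
proof (induction ks \<eta>s n rule: polylog_coeff.induct)
  case (1 k ks \<eta> \<eta>s n)
  show ?case
  proof (cases "n = 0")
    case False
    have "norm (\<Sum>m<n. polylog_coeff ks \<eta>s m) \<le> (\<Sum>m<n. 1)"
      using 1 by (intro sum_norm_le) (auto simp: composition_def)
    also have "\<dots> \<le> real n ^ k"
      using False 1 by (simp add: composition_def self_le_power)
    finally show ?thesis
      using False 1 by (simp add: norm_mult norm_divide norm_power field_simps)
  qed (use 1 in \<open>auto simp: composition_def\<close>)
qed auto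

section \<open>Decay of the coefficients like \<open>1 / sqrt n\<close>\<close>

lemma sum_inverse_sqrt_le: "(\<Sum>m=1..n. 1 / sqrt (real m)) \<le> 2 * sqrt (real n)"
proof (induction n)
  case (Suc n)
  define s t where "s = sqrt (real n)" and "t = sqrt (real (Suc n))"
  have st: "s \<ge> 0" "t > 0" "t\<^sup>2 = s\<^sup>2 + 1"
    by (auto simp: s_def t_def)
  \<comment> \<open>Expanding with \<open>t\<^sup>2 = s\<^sup>2 + 1\<close> gives
    \<open>2 * (t - s) * t = 1 + (t - s)\<^sup>2\<close>; the bound then telescopes.\<close>
  have "1 \<le> 2 * (t - s) * t"
    using st sum_power2_ge_zero[of "t - s" 0] by (simp add: power2_eq_square algebra_simps)
  then have "1 / t \<le> 2 * (t - s)"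
    using st by (simp add: field_simps)
  then show ?case using Suc by (simp add: s_def t_def)
qed simp

text \<open>The exponent 1/2 is a convenient choice inside (0, 1): summing up to \<open>n\<close>
  and dividing by \<open>n\<close> reproduces this order, whereas a bound of order
  \<open>1 / n\<close> would pick up logarithms. One further division by \<open>n\<close> yields the
  summable order \<open>n powr (- 3 / 2)\<close>. Since division by 0 gives 0, the bound at
  \<open>n = 0\<close> forces \<open>a 0 = 0\<close>.\<close>

definition inverse_sqrt_bounded :: "(nat \<Rightarrow> complex) \<Rightarrow> bool" where
  "inverse_sqrt_bounded a \<longleftrightarrow> (\<exists>K. \<forall>n. norm (a n) \<le> K / sqrt (real n))"

text \<open>Induction on the depth: the inner sum is at most \<open>2 * K * sqrt n\<close>, and
  dividing by \<open>n ^ k \<ge> n\<close> restores the order while doubling the constant.\<close>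

lemma inverse_sqrt_bounded_polylog_coeff:
  assumes "composition (k # ks)" "length \<eta>s = length (k # ks)" "\<forall>\<eta>\<in>set \<eta>s. norm \<eta> = 1"
  shows "inverse_sqrt_bounded (polylog_coeff (k # ks) \<eta>s)"
  using assms
proof (induction ks arbitrary: k \<eta>s)
  case Nil
  then obtain \<eta> where \<eta>: "\<eta>s = [\<eta>]" "norm \<eta> = 1" by (cases \<eta>s) auto
  have "norm (polylog_coeff [k] [\<eta>] n) \<le> 1 / sqrt (real n)" for n
  proof (cases "n = 0")
    case False
    have "sqrt (real n) \<le> real n"
      using False by (intro real_le_lsqrt) (auto simp: self_le_power)
    also have "\<dots> \<le> real n ^ k"
      using False Nil by (simp add: composition_def self_le_power)
    finally show ?thesis
      using False \<eta> by (simp add: norm_mult norm_divide norm_power field_simps)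
  qed (use Nil in \<open>auto simp: composition_def\<close>)
  then show ?case unfolding inverse_sqrt_bounded_def \<eta> by blast
next
  case (Cons k' ks k \<eta>s)
  then obtain \<eta> \<eta>s' where \<eta>: "\<eta>s = \<eta> # \<eta>s'" "norm \<eta> = 1" "length \<eta>s' = length (k' # ks)"
    "\<forall>\<eta>\<in>set \<eta>s'. norm \<eta> = 1" by (cases \<eta>s) auto
  let ?b = "polylog_coeff (k' # ks) \<eta>s'"
  have "inverse_sqrt_bounded ?b"
    using Cons.IH[OF _ \<eta>(3,4)] Cons.prems by (simp add: composition_def)
  then obtain K where K: "norm (?b n) \<le> K / sqrt (real n)" for n
    unfolding inverse_sqrt_bounded_def by blast
  have K0: "0 \<le> K" using order_trans[OF norm_ge_zero K[of 1]] by simp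
  have "norm (polylog_coeff (k # k' # ks) \<eta>s n) \<le> (2 * K) / sqrt (real n)" for n
  proof (cases "n = 0")
    case False
    have "norm (\<Sum>m<n. ?b m) \<le> (\<Sum>m<n. K / sqrt (real m))"
      using K by (intro sum_norm_le) auto
    also have "\<dots> \<le> (\<Sum>m\<le>n. K / sqrt (real m))"
      using K0 by (intro sum_mono2) auto
    also have "\<dots> = K * (\<Sum>m=1..n. 1 / sqrt (real m))"
      unfolding sum_distrib_left by (rule sum.mono_neutral_cong_right) (auto simp: not_le Suc_le_eq)
    also have "\<dots> \<le> K * (2 * sqrt (real n))"
      using K0 sum_inverse_sqrt_le by (intro mult_left_mono) auto
    finally have *: "norm (\<Sum>m<n. ?b m) \<le> 2 * K * sqrt (real n)" by simp
    have "real n \<le> real n ^ k"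
      using False Cons.prems by (simp add: composition_def self_le_power)
    then have "norm (\<Sum>m<n. ?b m) / real n ^ k \<le> 2 * K * sqrt (real n) / real n"
      using * K0 False by (intro frac_le) auto
    also have "\<dots> = 2 * K / sqrt (real n)"
      using False by (simp add: field_simps)
    finally show ?thesis
      using \<eta> by (simp add: norm_mult norm_divide norm_power)
  qed (use Cons \<eta> in \<open>auto simp: composition_def\<close>)
  then show ?case unfolding inverse_sqrt_bounded_def by blast
qed

section \<open>Integration operators on coefficients and the rational spaces of fixed weight\<close>

text \<open>
  The effect on Taylor coefficients at \<open>0\<close> of \<open>f \<mapsto> \<integral> f dx / x\<close> and
  \<open>f \<mapsto> \<integral> \<eta> f dx / (1 - \<eta> x)\<close>; both new coefficients at \<open>n = 0\<close> vanish since \<open>x / 0 = 0\<close>.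
\<close>
definition dlog_coeff :: "(nat \<Rightarrow> complex) \<Rightarrow> nat \<Rightarrow> complex" where
  "dlog_coeff a n = a n / of_nat n"

definition geometric_coeff :: "complex \<Rightarrow> (nat \<Rightarrow> complex) \<Rightarrow> nat \<Rightarrow> complex" where
  "geometric_coeff \<eta> a n = \<eta> ^ n / of_nat n * (\<Sum>m<n. a m / \<eta> ^ m)"

lemma dlog_coeff_polylog_coeff:
  "length \<eta>s = length (k # ks) \<Longrightarrow>
    dlog_coeff (polylog_coeff (k # ks) \<eta>s) = polylog_coeff (Suc k # ks) \<eta>s"
  by (cases \<eta>s) (auto simp: dlog_coeff_def fun_eq_iff)

lemma geometric_coeff_polylog_coeff_Nil:
  "geometric_coeff \<eta> (polylog_coeff [] []) = polylog_coeff [1] [\<eta>]"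
proof -
  have "(\<Sum>m<n. (if m = 0 then 1 else 0) / \<eta> ^ m) = (\<Sum>m<n. if m = 0 then 1 else 0)" for n
    by (rule sum.cong) auto
  then show ?thesis
    by (simp add: geometric_coeff_def fun_eq_iff)
qed

text \<open>The factors \<open>1 / \<eta> ^ m\<close> inside the sum are absorbed by the next root,
  turning \<zeta> into \<open>\<zeta> / \<eta>\<close>; this is again an \<open>N\<close>th root of
  unity when both are.\<close>

lemma geometric_coeff_polylog_coeff_Cons:
  "geometric_coeff \<eta> (polylog_coeff (k # ks) (\<zeta> # \<zeta>s)) = polylog_coeff (1 # k # ks) (\<eta> # \<zeta> / \<eta> # \<zeta>s)"
  by (simp add: geometric_coeff_def fun_eq_iff power_divide mult.commute)

text \<open>The rational span of the weight \<open>w\<close> coefficient sequences at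
  \<open>N\<close>th roots of unity, generated inductively so that closure properties can be checked
  on generators, sums and multiples. Sequences whose series diverges at 1 are included, since
  convergence is only required after a final integration against \<open>dx / x\<close>.\<close>

inductive_set polylog_space :: "nat \<Rightarrow> nat \<Rightarrow> (nat \<Rightarrow> complex) set" for N w where
  base: "composition ks \<Longrightarrow> sum_list ks = w \<Longrightarrow> length \<eta>s = length ks \<Longrightarrow> (\<forall>\<eta>\<in>set \<eta>s. \<eta> ^ N = 1) \<Longrightarrow>
    polylog_coeff ks \<eta>s \<in> polylog_space N w"
| add: "a \<in> polylog_space N w \<Longrightarrow> b \<in> polylog_space N w \<Longrightarrow> (\<lambda>n. a n + b n) \<in> polylog_space N w"
| scale: "a \<in> polylog_space N w \<Longrightarrow> (\<lambda>n. of_rat q * a n) \<in> polylog_space N w"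

lemma norm_eq_one_if_root:
  fixes \<eta> :: complex
  assumes "\<eta> ^ N = 1" "0 < N" shows "norm \<eta> = 1"
  using assms power_eq_1_iff by blast

text \<open>Positive weight guarantees a leading exponent, and integrating against
  \<open>dx / x\<close> raises it by one.\<close>

lemma dlog_coeff_polylog_space:
  assumes "a \<in> polylog_space N w" "0 < w"
  shows "dlog_coeff a \<in> polylog_space N (Suc w)"
  using assms(1)
proof induction
  case (base ks \<eta>s)
  then obtain k ks' where "ks = k # ks'" using assms(2) by (cases ks) auto
  then show ?case using base
    by (auto simp: dlog_coeff_polylog_coeff composition_def intro!: polylog_space.base)
next
  case (add a b)
  show ?case using polylog_space.add[OF add.IH] by (simp add: dlog_coeff_def add_divide_distrib)
next
  case (scale a q)
  show ?case using polylog_space.scale[OF scale.IH, of q] by (simp add: dlog_coeff_def)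
qed

lemma geometric_coeff_polylog_space:
  assumes "a \<in> polylog_space N w" "\<eta> ^ N = 1"
  shows "geometric_coeff \<eta> a \<in> polylog_space N (Suc w)"
  using assms(1)
proof induction
  case (base ks \<eta>s)
  show ?case
  proof (cases ks)
    case Nil
    then have "geometric_coeff \<eta> (polylog_coeff ks \<eta>s) = polylog_coeff [1] [\<eta>]"
      using base by (simp add: geometric_coeff_polylog_coeff_Nil)
    moreover have "polylog_coeff [1] [\<eta>] \<in> polylog_space N (Suc w)"
      using base assms Nil by (intro polylog_space.base) (auto simp: composition_def)
    ultimately show ?thesis by (simp only:)
  next
    case (Cons k ks')
    then obtain \<zeta> \<zeta>s where "\<eta>s = \<zeta> # \<zeta>s" using base by (cases \<eta>s) auto
    then show ?thesis using base assms Cons unfolding Cons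
      by (auto simp: geometric_coeff_polylog_coeff_Cons composition_def power_divide
          simp del: polylog_coeff.simps intro!: polylog_space.base)
  qed
next
  case (add a b)
  show ?case using polylog_space.add[OF add.IH]
    by (simp add: geometric_coeff_def add_divide_distrib sum.distrib ring_distribs)
next
  case (scale a q)
  show ?case using polylog_space.scale[OF scale.IH, of q]
    by (simp add: geometric_coeff_def sum_distrib_left mult_ac)
qed

lemma inverse_sqrt_bounded_polylog_space:
  assumes "a \<in> polylog_space N w" "0 < w" "0 < N"
  shows "inverse_sqrt_bounded a"
  using assms(1)
proof induction
  case (base ks \<eta>s)
  then obtain k ks' where "ks = k # ks'" using assms(2) by (cases ks) auto
  then show ?case using base assms(3) norm_eq_one_if_root
    by (auto intro!: inverse_sqrt_bounded_polylog_coeff)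
next
  case (add a b)
  then obtain K L where "\<forall>n. norm (a n) \<le> K / sqrt (real n)" "\<forall>n. norm (b n) \<le> L / sqrt (real n)"
    unfolding inverse_sqrt_bounded_def by blast
  then have "\<forall>n. norm (a n + b n) \<le> (K + L) / sqrt (real n)"
    by (auto simp: add_divide_distrib intro!: norm_triangle_le add_mono)
  then show ?case unfolding inverse_sqrt_bounded_def by blast
next
  case (scale a q)
  then obtain K where "\<forall>n. norm (a n) \<le> K / sqrt (real n)"
    unfolding inverse_sqrt_bounded_def by blast
  then have "\<forall>n. norm (of_rat q * a n) \<le> (norm (of_rat q :: complex) * K) / sqrt (real n)"
    by (auto simp: norm_mult mult_left_mono simp flip: times_divide_eq_right)
  then show ?case unfolding inverse_sqrt_bounded_def by blast
qed

lemma inverse_sqrt_bounded_0: "inverse_sqrt_bounded a \<Longrightarrow> a 0 = 0"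
  unfolding inverse_sqrt_bounded_def by (metis div_by_0 norm_le_zero_iff of_nat_0 real_sqrt_zero)

lemma summable_norm_dlog_coeff:
  assumes "inverse_sqrt_bounded a"
  shows "summable (\<lambda>n. norm (dlog_coeff a n))"
proof -
  obtain K where K: "\<And>n. norm (a n) \<le> K / sqrt (real n)"
    using assms unfolding inverse_sqrt_bounded_def by blast
  have "summable (\<lambda>n. K * real n powr (- 3 / 2))"
    by (intro summable_mult) (simp add: summable_real_powr_iff)
  then show ?thesis
  proof (rule summable_comparison_test')
    fix n :: nat assume "0 \<le> n"
    have "norm (dlog_coeff a n) \<le> (K / sqrt (real n)) / real n"
      unfolding dlog_coeff_def norm_divide norm_of_nat by (rule divide_right_mono[OF K]) simp
    also have "\<dots> = K * real n powr (- 3 / 2)"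
    proof (cases "n = 0")
      case False
      have "real n powr (- 3 / 2) = real n powr (- (1 / 2)) * real n powr - 1"
        by (subst powr_add[symmetric]) simp
      also have "\<dots> = 1 / sqrt (real n) / real n"
        using False by (simp only: powr_minus_divide powr_half_sqrt of_nat_0_le_iff) simp
      finally show ?thesis by simp
    qed simp
    finally show "norm (norm (dlog_coeff a n)) \<le> K * real n powr (- 3 / 2)" by simp
  qed
qed

section \<open>Values at 1 as elements of the span of convergent values\<close>

lemma module_rat_scale: "module rat_scale"
  using vector_space_rat_scale by (simp add: vector_space_def module_def)

lemma Li_eq_suminf_polylog_coeff:
  assumes "composition ks" "length \<eta>s = length ks" "summable (polylog_coeff ks \<eta>s)"
  shows "Li_convergent ks \<eta>s" "Li ks \<eta>s = suminf (polylog_coeff ks \<eta>s)"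
proof -
  have "Li_trunc ks \<eta>s \<longlonglongrightarrow> suminf (polylog_coeff ks \<eta>s)"
    using summable_LIMSEQ'[OF assms(3)] assms(1,2)
    by (simp add: fun_eq_iff[THEN iffD2, OF allI, OF Li_trunc_eq_sum_polylog_coeff])
  then show "Li_convergent ks \<eta>s" "Li ks \<eta>s = suminf (polylog_coeff ks \<eta>s)"
    by (auto simp: Li_convergent_def Li_def limI convergent_def)
qed

text \<open>On a generator the last integration makes the leading exponent at least 2, so the value
  at 1 converges absolutely and no regularisation enters. Summability then lets sums and rational
  multiples pass through the series.\<close>

lemma suminf_dlog_coeff_in_CMZV:
  assumes "a \<in> polylog_space N w" "0 < w" "0 < N"
  shows "suminf (dlog_coeff a) \<in> CMZV N (Suc w)"
  using assms(1)
proof induction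
  case (base ks \<eta>s)
  then obtain k ks' where ks: "ks = k # ks'" using assms(2) by (cases ks) auto
  have *: "dlog_coeff (polylog_coeff ks \<eta>s) = polylog_coeff (Suc k # ks') \<eta>s"
    using base ks by (simp add: dlog_coeff_polylog_coeff)
  have "summable (dlog_coeff (polylog_coeff ks \<eta>s))"
    using base assms
    by (intro summable_norm_cancel[OF summable_norm_dlog_coeff] inverse_sqrt_bounded_polylog_space
        polylog_space.base)
  then have "Li_convergent (Suc k # ks') \<eta>s"
      "Li (Suc k # ks') \<eta>s = suminf (dlog_coeff (polylog_coeff ks \<eta>s))"
    using base ks unfolding * by (auto intro!: Li_eq_suminf_polylog_coeff simp: composition_def)
  then show ?case
    unfolding CMZV_def using base ks
    by (intro module.span_base[OF module_rat_scale] CollectI exI[of _ "Suc k # ks'"] exI[of _ \<eta>s])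
      (auto simp: composition_def)
next
  case (add a b)
  have "summable (dlog_coeff a)" "summable (dlog_coeff b)"
    using add assms
    by (auto intro!: summable_norm_cancel[OF summable_norm_dlog_coeff] inverse_sqrt_bounded_polylog_space)
  then have "suminf (dlog_coeff (\<lambda>n. a n + b n)) = suminf (dlog_coeff a) + suminf (dlog_coeff b)"
    by (subst suminf_add) (auto simp: dlog_coeff_def add_divide_distrib intro!: suminf_cong)
  then show ?case
    using add.IH module.span_add[OF module_rat_scale] unfolding CMZV_def by simp
next
  case (scale a q)
  have "summable (dlog_coeff a)"
    using scale assms
    by (auto intro!: summable_norm_cancel[OF summable_norm_dlog_coeff] inverse_sqrt_bounded_polylog_space)
  then have "suminf (dlog_coeff (\<lambda>n. of_rat q * a n)) = of_rat q * suminf (dlog_coeff a)"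
    by (subst suminf_mult[symmetric]) (auto simp: dlog_coeff_def intro!: suminf_cong)
  then show ?case
    using scale.IH module.span_scale[OF module_rat_scale] unfolding CMZV_def by simp
qed

section \<open>Power series in the unit disc and the differential equations of the two
  operators\<close>

definition powser :: "(nat \<Rightarrow> complex) \<Rightarrow> complex \<Rightarrow> complex" where
  "powser a z = (\<Sum>n. a n * z ^ n)"

lemma summable_powser:
  fixes a :: "nat \<Rightarrow> complex"
  assumes "Bseq a" "norm z < 1"
  shows "summable (\<lambda>n. a n * z ^ n)"
proof -
  obtain K where K: "\<And>n. norm (a n) \<le> K" using assms(1) unfolding Bseq_def by blast
  have "summable (\<lambda>n. K * norm z ^ n)"
    using assms(2) by (intro summable_mult summable_geometric) simp
  then show ?thesis
    by (rule summable_comparison_test') (simp add: norm_mult norm_power K mult_right_mono)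
qed

lemma summable_powser_diffs:
  fixes a :: "nat \<Rightarrow> complex"
  assumes "Bseq a" "norm z < 1"
  shows "summable (\<lambda>n. diffs a n * z ^ n)"
  using assms by (intro termdiff_converges[where K = 1] summable_powser)

lemma DERIV_powser:
  assumes "Bseq a" "norm z < 1"
  shows "(powser a has_field_derivative powser (diffs a) z) (at z)"
  unfolding powser_def using assms by (intro termdiffs_strong'[where K = 1] summable_powser)

lemma powser_0 [simp]: "powser a 0 = a 0"
  by (simp add: powser_def)

lemma powser_polylog_coeff_Nil: "powser (polylog_coeff [] []) z = 1"
  unfolding powser_def by (subst suminf_finite[of "{0}"]) auto

lemma powser_diffs_add:
  assumes "Bseq a" "Bseq b" "norm z < 1"
  shows "powser (diffs (\<lambda>n. a n + b n)) z = powser (diffs a) z + powser (diffs b) z"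
  using assms unfolding powser_def
  by (subst suminf_add) (simp_all add: summable_powser_diffs, simp add: diffs_def algebra_simps)

lemma powser_diffs_cmult:
  assumes "Bseq a" "norm z < 1"
  shows "powser (diffs (\<lambda>n. k * a n)) z = k * powser (diffs a) z"
  using assms unfolding powser_def
  by (subst suminf_mult[symmetric]) (simp_all add: summable_powser_diffs, simp add: diffs_def algebra_simps)

lemma Bseq_inverse_sqrt_bounded:
  assumes "inverse_sqrt_bounded a" shows "Bseq a"
proof -
  obtain K where K: "\<And>n. norm (a n) \<le> K / sqrt (real n)"
    using assms unfolding inverse_sqrt_bounded_def by blast
  have K0: "0 \<le> K" using order_trans[OF norm_ge_zero K[of 1]] by simp
  have "norm (a n) \<le> K" for n
  proof (cases "n = 0")
    case False
    then have "K / sqrt (real n) \<le> K / 1" using K0 by (intro divide_left_mono) auto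
    then show ?thesis using K[of n] by simp
  qed (use K[of 0] K0 in auto)
  then show ?thesis by (rule BseqI')
qed

lemma Bseq_cmult: "Bseq a \<Longrightarrow> Bseq (\<lambda>n. k * a n :: complex)"
  by (elim BseqE, rule BseqI'[of _ "norm k * _"]) (auto simp: norm_mult intro: mult_left_mono)

lemma Bseq_plus: "Bseq a \<Longrightarrow> Bseq b \<Longrightarrow> Bseq (\<lambda>n. a n + b n :: complex)"
  by (elim BseqE, rule BseqI') (rule norm_triangle_le, rule add_mono, blast+)

lemma Bseq_dlog_coeff:
  assumes "Bseq a" shows "Bseq (dlog_coeff a)"
proof -
  obtain K where K: "K > 0" "\<And>n. norm (a n) \<le> K" using assms by (auto elim: BseqE)
  have "norm (dlog_coeff a n) \<le> K" for n
  proof (cases "n = 0")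
    case False
    then have "norm (dlog_coeff a n) \<le> norm (a n) / 1"
      unfolding dlog_coeff_def norm_divide norm_of_nat by (intro divide_left_mono) auto
    then show ?thesis using K(2)[of n] by simp
  qed (use K in \<open>auto simp: dlog_coeff_def\<close>)
  then show ?thesis by (rule BseqI')
qed

lemma Bseq_geometric_coeff:
  assumes "Bseq a" "norm \<eta> = 1" shows "Bseq (geometric_coeff \<eta> a)"
proof -
  obtain K where K: "K > 0" "\<And>n. norm (a n) \<le> K" using assms by (auto elim: BseqE)
  have "norm (geometric_coeff \<eta> a n) \<le> K" for n
  proof (cases "n = 0")
    case False
    have "norm (\<Sum>m<n. a m / \<eta> ^ m) \<le> (\<Sum>m<n. K)"
      using K assms(2) by (intro sum_norm_le) (auto simp: norm_divide norm_power)
    then show ?thesis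
      using False assms(2) by (simp add: geometric_coeff_def norm_mult norm_divide norm_power field_simps)
  qed (use K in \<open>auto simp: geometric_coeff_def\<close>)
  then show ?thesis by (rule BseqI')
qed

lemma powser_diffs_dlog_coeff:
  assumes "Bseq a" "a 0 = 0" "norm z < 1"
  shows "z * powser (diffs (dlog_coeff a)) z = powser a z"
proof -
  have "diffs (dlog_coeff a) n = a (Suc n)" for n
    by (simp add: diffs_def dlog_coeff_def del: of_nat_Suc)
  moreover have "summable (\<lambda>n. a n * z ^ n)"
    using assms by (simp add: summable_powser)
  ultimately show ?thesis
    using powser_split_head(1)[of a z] assms(2) by (simp add: powser_def mult.commute)
qed

text \<open>The sequence \<open>b = geometric_coeff \<eta> a\<close> satisfies
  \<open>(n + 1) * b (n + 1) = \<eta> * (n * b n + a n)\<close>. Summed against \<open>z ^ n\<close>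
  this reads \<open>b' = \<eta> * (z * b' + a)\<close> for the generating functions.\<close>

lemma powser_diffs_geometric_coeff:
  assumes "Bseq a" "norm \<eta> = 1" "norm z < 1"
  shows "(1 - \<eta> * z) * powser (diffs (geometric_coeff \<eta> a)) z = \<eta> * powser a z"
proof -
  define b where "b = geometric_coeff \<eta> a"
  have \<eta>: "\<eta> \<noteq> 0" using assms(2) by auto
  have nb: "of_nat n * b n = \<eta> ^ n * (\<Sum>m<n. a m / \<eta> ^ m)" for n
    by (cases "n = 0") (simp_all add: b_def geometric_coeff_def)
  have rec: "diffs b n = \<eta> * (of_nat n * b n + a n)" for n
    unfolding diffs_def nb using \<eta> by (simp add: field_simps)
  have Bb: "Bseq b" unfolding b_def using assms by (intro Bseq_geometric_coeff)
  have s1: "summable (\<lambda>n. diffs b n * z ^ n)" and s2: "summable (\<lambda>n. a n * z ^ n)"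
    using assms Bb by (auto intro: summable_powser summable_powser_diffs)
  \<comment> \<open>The recurrence writes the series of \<open>n * b n\<close> as a difference of
    two series already known to converge.\<close>
  have "(\<lambda>n. of_nat n * b n * z ^ n) = (\<lambda>n. (diffs b n * z ^ n) / \<eta> - a n * z ^ n)"
    using \<eta> by (simp add: rec fun_eq_iff field_simps)
  then have s3: "summable (\<lambda>n. of_nat n * b n * z ^ n)"
    using s1 s2 by (simp add: summable_diff summable_divide)
  have "(\<Sum>n. of_nat n * b n * z ^ n) = z * powser (diffs b) z"
    using powser_split_head(1)[OF s3] by (simp add: powser_def diffs_def mult.commute)
  moreover have "powser (diffs b) z = \<eta> * ((\<Sum>n. of_nat n * b n * z ^ n) + powser a z)"
    unfolding powser_def using s2 s3
    by (simp add: suminf_add suminf_mult[symmetric] summable_add rec algebra_simps)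
  ultimately show ?thesis by (simp add: b_def algebra_simps)
qed

lemma powser_diffs_geometric_coeff':
  assumes "Bseq a" "norm \<eta> = 1" "norm z < 1"
  shows "powser (diffs (geometric_coeff \<eta> a)) z = \<eta> * powser a z / (1 - \<eta> * z)"
proof -
  have "norm (\<eta> * z) < 1" using assms by (simp add: norm_mult)
  then have "1 - \<eta> * z \<noteq> 0" by auto
  then show ?thesis
    using powser_diffs_geometric_coeff[OF assms] by (simp add: field_simps)
qed

section \<open>The substitution \<open>u\<close> and the pullback of the two differential
  forms\<close>

text \<open>The \<open>u\<close> of the overview. For \<open>c < 1\<close> it maps [0, 1) into [0,
  1), so power series with bounded coefficients may be evaluated along it, and it fixes both 0 and
  1.\<close>

definition unit_kernel :: "real \<Rightarrow> real \<Rightarrow> real" where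
  "unit_kernel c x = (1 - c) * (2 * x) / (1 - 2 * c * x + x\<^sup>2)"

lemma unit_kernel_denom_pos:
  fixes c x :: real
  assumes "c < 1" "0 \<le> x" "x \<le> 1"
  shows "0 < 1 - 2 * c * x + x\<^sup>2"
proof -
  have eq: "1 - 2 * c * x + x\<^sup>2 = (1 - x)\<^sup>2 + 2 * x * (1 - c)"
    by (simp add: power2_eq_square algebra_simps)
  show ?thesis
  proof (cases "x = 0")
    case False
    then have "0 < 2 * x * (1 - c)" using assms by simp
    then show ?thesis unfolding eq using zero_le_power2[of "1 - x"] by linarith
  qed simp
qed

lemma one_minus_unit_kernel:
  assumes "c < 1" "0 \<le> x" "x \<le> 1"
  shows "1 - unit_kernel c x = (1 - x)\<^sup>2 / (1 - 2 * c * x + x\<^sup>2)"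
  using unit_kernel_denom_pos[OF assms]
  by (simp add: unit_kernel_def divide_simps) (simp add: power2_eq_square algebra_simps)

lemma unit_kernel_bounds:
  assumes "c < 1" "0 \<le> x" "x < 1"
  shows "0 \<le> unit_kernel c x" "unit_kernel c x < 1"
proof -
  show "0 \<le> unit_kernel c x"
    using assms unit_kernel_denom_pos[of c x] by (simp add: unit_kernel_def)
  have "0 < 1 - unit_kernel c x"
    using assms unit_kernel_denom_pos[of c x] by (subst one_minus_unit_kernel) auto
  then show "unit_kernel c x < 1" by simp
qed

lemma DERIV_unit_kernel:
  assumes "c < 1" "0 \<le> x" "x \<le> 1"
  shows "(unit_kernel c has_real_derivative
    2 * (1 - c) * (1 - x\<^sup>2) / (1 - 2 * c * x + x\<^sup>2)\<^sup>2) (at x)"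
  unfolding unit_kernel_def using unit_kernel_denom_pos[OF assms]
  by (auto intro!: derivative_eq_intros simp: divide_simps)
     (auto simp: power2_eq_square algebra_simps)

text \<open>Both sides agree at 0 because \<open>u 0 = 0\<close>, and by the chain rule the
  hypothesis says that their derivatives agree on (0, 1).\<close>

lemma powser_unit_kernel_eqI:
  assumes c: "c < 1" and b: "Bseq b" and d: "Bseq d" and "b 0 = d 0"
    and deriv: "\<And>x. 0 < x \<Longrightarrow> x < 1 \<Longrightarrow>
      of_real (2 * (1 - c) * (1 - x\<^sup>2) / (1 - 2 * c * x + x\<^sup>2)\<^sup>2)
        * powser (diffs b) (of_real (unit_kernel c x)) = powser (diffs d) (of_real x)"
    and x: "0 \<le> x" "x < 1"
  shows "powser b (of_real (unit_kernel c x)) = powser d (of_real x)"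
proof -
  define h where "h = (\<lambda>x. powser b (of_real (unit_kernel c x)) - powser d (of_real x))"
  have der: "(h has_vector_derivative
      of_real (2 * (1 - c) * (1 - y\<^sup>2) / (1 - 2 * c * y + y\<^sup>2)\<^sup>2) * powser (diffs b) (of_real (unit_kernel c y))
        - powser (diffs d) (of_real y)) (at y)" if y: "0 \<le> y" "y < 1" for y
  proof -
    have 1: "((\<lambda>x. complex_of_real (unit_kernel c x)) has_vector_derivative
        of_real (2 * (1 - c) * (1 - y\<^sup>2) / (1 - 2 * c * y + y\<^sup>2)\<^sup>2)) (at y)"
      using DERIV_unit_kernel[OF c, of y] y
      by (intro has_vector_derivative_of_real) (auto simp: has_real_derivative_iff_has_vector_derivative)
    have 2: "(powser b has_field_derivative powser (diffs b) (of_real (unit_kernel c y)))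
        (at (of_real (unit_kernel c y)))"
      using unit_kernel_bounds[OF c y] by (intro DERIV_powser b) simp
    have 3: "(powser d has_field_derivative powser (diffs d) (of_real y)) (at (of_real y))"
      using y by (intro DERIV_powser d) simp
    show ?thesis
      unfolding h_def
      using field_vector_diff_chain_at[OF 1 2] has_vector_derivative_real_field[OF 3]
      by (intro has_vector_derivative_diff) (simp_all add: o_def)
  qed
  have "h x = 0"
  \<comment> \<open>The derivative identity is assumed only for positive arguments, so that
    \<open>x\<close> and \<open>u\<close> may be divided by when proving it; the point 0 is
    exceptional and is covered by continuity.\<close>
  proof (rule has_derivative_zero_unique_strong_interval[of "{0}" 0 x h 0 x])
    show "continuous_on {0..x} h"
      using x
      by (intro continuous_at_imp_continuous_on ballI has_vector_derivative_continuous[OF der]) auto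
    show "h 0 = 0" using assms by (simp add: h_def unit_kernel_def)
    fix y assume "y \<in> {0..x} - {0}"
    then have y: "0 < y" "y < 1" using x by auto
    from der[of y] y have "(h has_vector_derivative 0) (at y)" by (simp only: deriv) simp
    then show "(h has_derivative (\<lambda>h. 0)) (at y within {0..x})"
      by (auto simp: has_vector_derivative_def intro: has_derivative_at_withinI)
  qed (use x in auto)
  then show ?thesis by (simp add: h_def)
qed

context
  fixes \<mu> :: complex and c :: real
  assumes norm_\<mu>: "norm \<mu> = 1" and \<mu>_ne_1: "\<mu> \<noteq> 1" and c_def: "c = Re \<mu>"
begin

text \<open>On the unit circle real part 1 occurs only at the point 1.\<close>

lemma Re_lt_one: "c < 1"
  using norm_\<mu> \<mu>_ne_1 c_def complex_Re_le_cmod[of \<mu>] cmod_power2[of \<mu>]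
  by (cases "c = 1") (auto simp: complex_eq_iff)

lemma \<mu>_cnj: "\<mu> * cnj \<mu> = 1" "\<mu> + cnj \<mu> = 2 * of_real c"
  using norm_\<mu> c_def by (simp_all add: complex_norm_square[symmetric] complex_add_cnj)

lemma denom_factor:
  "complex_of_real (1 - 2 * c * x + x\<^sup>2) = (1 - \<mu> * of_real x) * (1 - cnj \<mu> * of_real x)"
proof -
  have "(1 - \<mu> * of_real x) * (1 - cnj \<mu> * of_real x) = 1 - (\<mu> + cnj \<mu>) * of_real x + (\<mu> * cnj \<mu>) * (of_real x)\<^sup>2"
    by (simp add: algebra_simps power2_eq_square)
  then show ?thesis by (simp add: \<mu>_cnj)
qed

lemma linear_factors_nonzero:
  assumes "0 \<le> x" "x \<le> 1"
  shows "1 - \<mu> * of_real x \<noteq> 0" "1 - cnj \<mu> * of_real x \<noteq> 0"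
proof -
  have "complex_of_real (1 - 2 * c * x + x\<^sup>2) \<noteq> 0"
    using unit_kernel_denom_pos[OF Re_lt_one assms] by (simp only: of_real_eq_0_iff)
  then show "1 - \<mu> * of_real x \<noteq> 0" "1 - cnj \<mu> * of_real x \<noteq> 0"
    unfolding denom_factor by auto
qed

text \<open>
  \<open>u' / u = 1 / x + \<mu> / (1 - \<mu> x) + cnj \<mu> / (1 - cnj \<mu> x)\<close>
\<close>
lemma powser_dlog_coeff_unit_kernel:
  assumes C: "Bseq C" "C 0 = 0" and a: "Bseq a" "a 0 = 0"
    and eq: "\<And>x. 0 \<le> x \<Longrightarrow> x < 1 \<Longrightarrow> powser C (of_real (unit_kernel c x)) = powser a (of_real x)"
    and x: "0 \<le> x" "x < 1"
  shows "powser (dlog_coeff C) (of_real (unit_kernel c x)) =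
    powser (\<lambda>n. dlog_coeff a n + (geometric_coeff \<mu> a n + geometric_coeff (cnj \<mu>) a n)) (of_real x)"
proof (rule powser_unit_kernel_eqI[OF Re_lt_one _ _ _ _ x])
  fix x :: real assume x: "0 < x" "x < 1"
  define q where "q = 1 - 2 * c * x + x\<^sup>2"
  define A where "A = powser a (of_real x)"
  let ?u = "complex_of_real (unit_kernel c x)" and ?x = "complex_of_real x"
  let ?P = "1 - \<mu> * ?x" and ?Q = "1 - cnj \<mu> * ?x"
  have q: "q > 0" using unit_kernel_denom_pos[OF Re_lt_one, of x] x by (simp add: q_def)
  have u: "unit_kernel c x > 0" "norm ?u < 1"
    using unit_kernel_bounds(2)[OF Re_lt_one, of x] x q Re_lt_one
    unfolding norm_of_real by (simp_all add: unit_kernel_def q_def[symmetric])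
  have PQ: "?P \<noteq> 0" "?Q \<noteq> 0" using linear_factors_nonzero[of x] x by auto
  have "?u * powser (diffs (dlog_coeff C)) ?u = A"
    using powser_diffs_dlog_coeff[OF C u(2)] eq[of x] x by (simp add: A_def)
  then have 1: "powser (diffs (dlog_coeff C)) ?u = A / ?u"
    using u(1) by (simp add: field_simps)
  have "?x * powser (diffs (dlog_coeff a)) ?x = A"
    using powser_diffs_dlog_coeff[OF a, of ?x] x by (simp add: A_def)
  then have 2: "powser (diffs (dlog_coeff a)) ?x = A / ?x"
    using x(1) by (simp add: field_simps)
  have "2 * (1 - c) * (1 - x\<^sup>2) / q\<^sup>2 / unit_kernel c x = (1 - x\<^sup>2) / (x * q)"
    using x q Re_lt_one unfolding unit_kernel_def q_def[symmetric]
    by (simp add: divide_simps) (simp add: power2_eq_square algebra_simps)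
  then have "of_real (2 * (1 - c) * (1 - x\<^sup>2) / q\<^sup>2) * (A / ?u) = A * of_real ((1 - x\<^sup>2) / (x * q))"
    by (metis (no_types, opaque_lifting) mult.commute of_real_divide times_divide_eq_right)
  also have "\<dots> = A * ((1 - ?x\<^sup>2) / (?x * (?P * ?Q)))"
    by (simp add: denom_factor[symmetric] q_def)
  \<comment> \<open>The numerators of the three partial fractions over the common denominator
    \<open>?x * (?P * ?Q)\<close>; the terms in \<open>x\<close> and the surplus of
    \<open>x\<^sup>2\<close> combine through \<open>\<mu> * cnj \<mu> = 1\<close>.\<close>
  also have "1 - ?x\<^sup>2 = ?P * ?Q + \<mu> * ?x * ?Q + cnj \<mu> * ?x * ?P"
    using \<mu>_cnj(1) by algebra
  also have "A * ((?P * ?Q + \<mu> * ?x * ?Q + cnj \<mu> * ?x * ?P) / (?x * (?P * ?Q)))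
      = A / ?x + (\<mu> * A / ?P + cnj \<mu> * A / ?Q)"
    using x PQ by (simp add: divide_simps) (simp add: algebra_simps)
  finally show "of_real (2 * (1 - c) * (1 - x\<^sup>2) / (1 - 2 * c * x + x\<^sup>2)\<^sup>2) * powser (diffs (dlog_coeff C)) ?u =
      powser (diffs (\<lambda>n. dlog_coeff a n + (geometric_coeff \<mu> a n + geometric_coeff (cnj \<mu>) a n))) ?x"
    using x a norm_\<mu> unfolding 1 q_def
    by (simp add: powser_diffs_add Bseq_plus Bseq_dlog_coeff Bseq_geometric_coeff 2
        powser_diffs_geometric_coeff' A_def)
next
  show "dlog_coeff C 0 = dlog_coeff a 0 + (geometric_coeff \<mu> a 0 + geometric_coeff (cnj \<mu>) a 0)"
    by (simp add: dlog_coeff_def geometric_coeff_def)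
qed (use C a norm_\<mu> in \<open>auto intro!: Bseq_plus Bseq_dlog_coeff Bseq_geometric_coeff\<close>)

text \<open>
  \<open>u' / (1 - u) = 2 / (1 - x) - \<mu> / (1 - \<mu> x) - cnj \<mu> / (1 - cnj \<mu> x)\<close>
\<close>
lemma powser_geometric_coeff_unit_kernel:
  assumes C: "Bseq C" and a: "Bseq a"
    and eq: "\<And>x. 0 \<le> x \<Longrightarrow> x < 1 \<Longrightarrow> powser C (of_real (unit_kernel c x)) = powser a (of_real x)"
    and x: "0 \<le> x" "x < 1"
  shows "powser (geometric_coeff 1 C) (of_real (unit_kernel c x)) =
    powser (\<lambda>n. 2 * geometric_coeff 1 a n + - 1 * (geometric_coeff \<mu> a n + geometric_coeff (cnj \<mu>) a n)) (of_real x)"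
proof (rule powser_unit_kernel_eqI[OF Re_lt_one _ _ _ _ x])
  fix x :: real assume x: "0 < x" "x < 1"
  define q where "q = 1 - 2 * c * x + x\<^sup>2"
  define A where "A = powser a (of_real x)"
  let ?u = "complex_of_real (unit_kernel c x)" and ?x = "complex_of_real x"
  let ?P = "1 - \<mu> * ?x" and ?Q = "1 - cnj \<mu> * ?x"
  have q: "q > 0" using unit_kernel_denom_pos[OF Re_lt_one, of x] x by (simp add: q_def)
  have u: "unit_kernel c x \<ge> 0" "unit_kernel c x < 1"
    using unit_kernel_bounds[OF Re_lt_one, of x] x by auto
  have PQ: "?P \<noteq> 0" "?Q \<noteq> 0" "1 - ?x \<noteq> 0" using linear_factors_nonzero[of x] x by auto
  have 1: "powser (diffs (geometric_coeff 1 C)) ?u = A / (1 - ?u)"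
    using powser_diffs_geometric_coeff'[OF C, of 1 ?u] eq[of x] x u by (simp add: A_def)
  \<comment> \<open>One factor \<open>1 - x\<close> of \<open>1 - x\<^sup>2\<close> cancels against
    the square in \<open>1 - u\<close>, leaving a simple pole at 1.\<close>
  have "2 * (1 - c) * (1 - x\<^sup>2) / q\<^sup>2 / (1 - unit_kernel c x) = 2 * (1 - c) * (1 + x) / ((1 - x) * q)"
    using x q by (subst one_minus_unit_kernel[OF Re_lt_one], simp, simp)
      (simp add: q_def[symmetric] divide_simps, simp add: power2_eq_square algebra_simps)
  then have "of_real (2 * (1 - c) * (1 - x\<^sup>2) / q\<^sup>2) * (A / (1 - ?u))
      = A * of_real (2 * (1 - c) * (1 + x) / ((1 - x) * q))"
    by (metis (no_types, opaque_lifting) mult.commute of_real_1 of_real_diff of_real_divide times_divide_eq_right)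
  also have "\<dots> = A * ((2 - 2 * of_real c) * (1 + ?x) / ((1 - ?x) * (?P * ?Q)))"
    unfolding denom_factor[symmetric] q_def by (simp add: right_diff_distrib)
  \<comment> \<open>Again the numerators of the partial fractions, now over
    \<open>(1 - ?x) * (?P * ?Q)\<close>, after replacing \<open>2 * c\<close> by
    \<open>\<mu> + cnj \<mu>\<close>.\<close>
  also have "(2 - 2 * of_real c) * (1 + ?x) = 2 * (?P * ?Q) - \<mu> * (1 - ?x) * ?Q - cnj \<mu> * (1 - ?x) * ?P"
    unfolding \<mu>_cnj(2)[symmetric] using \<mu>_cnj(1) by algebra
  also have "A * ((2 * (?P * ?Q) - \<mu> * (1 - ?x) * ?Q - cnj \<mu> * (1 - ?x) * ?P) / ((1 - ?x) * (?P * ?Q)))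
      = 2 * (A / (1 - ?x)) + - 1 * (\<mu> * A / ?P + cnj \<mu> * A / ?Q)"
    using x PQ by (simp add: divide_simps) (simp add: algebra_simps)
  finally show "of_real (2 * (1 - c) * (1 - x\<^sup>2) / (1 - 2 * c * x + x\<^sup>2)\<^sup>2) * powser (diffs (geometric_coeff 1 C)) ?u =
      powser (diffs (\<lambda>n. 2 * geometric_coeff 1 a n + - 1 * (geometric_coeff \<mu> a n + geometric_coeff (cnj \<mu>) a n))) ?x"
    using x a norm_\<mu> unfolding 1 q_def
    by (simp only: powser_diffs_add powser_diffs_cmult Bseq_plus Bseq_cmult Bseq_geometric_coeff
        powser_diffs_geometric_coeff' A_def norm_of_real complex_mod_cnj norm_one abs_of_pos) simp
next
  show "geometric_coeff 1 C 0 =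
      2 * geometric_coeff 1 a 0 + - 1 * (geometric_coeff \<mu> a 0 + geometric_coeff (cnj \<mu>) a 0)"
    by (simp add: geometric_coeff_def)
  show "Bseq (\<lambda>n. 2 * geometric_coeff 1 a n + - 1 * (geometric_coeff \<mu> a n + geometric_coeff (cnj \<mu>) a n))"
    using a norm_\<mu> by (intro Bseq_plus Bseq_cmult Bseq_geometric_coeff) auto
qed (use C in \<open>auto intro: Bseq_geometric_coeff\<close>)

end

section \<open>The integrals representing the sequence: recurrence and initial value\<close>

text \<open>This is \<open>(2 * x / q x) ^ (n + 1) / x\<close> with the division by \<open>x\<close>
  carried out, so that it is continuous at 0 as well.\<close>

definition moment_kernel :: "real \<Rightarrow> nat \<Rightarrow> real \<Rightarrow> real" where
  "moment_kernel c n x = 2 / (1 - 2 * c * x + x\<^sup>2) * (2 * x / (1 - 2 * c * x + x\<^sup>2)) ^ n"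

text \<open>The index is shifted: \<open>moment c n\<close> is the paper's \<open>F\<close> at \<open>n + 1\<close>.\<close>
definition moment :: "real \<Rightarrow> nat \<Rightarrow> real" where
  "moment c n = integral {0..1} (moment_kernel c n)"

lemma has_integral_moment_kernel:
  assumes "c < 1"
  shows "(moment_kernel c n has_integral moment c n) {0..1}"
proof -
  have "continuous_on {0..1} (moment_kernel c n)"
    unfolding moment_kernel_def using unit_kernel_denom_pos[OF assms]
    by (intro continuous_intros ballI) (auto dest: less_imp_neq[symmetric])
  then show ?thesis
    unfolding moment_def by (intro integrable_integral integrable_continuous_interval)
qed

lemma unit_kernel_power_Suc:
  "x \<noteq> 0 \<Longrightarrow> unit_kernel c x ^ Suc n / x = (1 - c) ^ Suc n * moment_kernel c n x"
  unfolding unit_kernel_def moment_kernel_def times_divide_eq_right[symmetric] power_mult_distrib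
  by simp

text \<open>With \<open>v = 2 x / q x\<close> and \<open>w = (1 - x\<^sup>2) / q x\<close>, integrate the derivative of \<open>- v ^ n w\<close>.\<close>
lemma moment_recurrence:
  assumes c: "c < 1"
  shows "(real n + 1) * (1 - c\<^sup>2) * moment c (Suc n) - (2 * real n + 1) * c * moment c n
    - real n * moment c (n - 1) = (if n = 0 then 1 else 0)"
proof -
  define q where "q = (\<lambda>x. 1 - 2 * c * x + x\<^sup>2)"
  define v where "v = (\<lambda>x. 2 * x / q x)"
  define w where "w = (\<lambda>x. (1 - x\<^sup>2) / q x)"
  \<comment> \<open>At \<open>n = 0\<close> the truncated index \<open>n - 1\<close> is 0, but its
    term carries the factor \<open>real n = 0\<close>.\<close>
  define R where "R = (\<lambda>x. (real n + 1) * (1 - c\<^sup>2) * moment_kernel c (Suc n) x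
    - (2 * real n + 1) * c * moment_kernel c n x - real n * moment_kernel c (n - 1) x)"
  have q: "q x > 0" if "0 \<le> x" "x \<le> 1" for x
    using unit_kernel_denom_pos[OF c that] by (simp add: q_def)
  have der: "((\<lambda>x. - (v x ^ n * w x)) has_real_derivative R x) (at x)" if x: "0 \<le> x" "x \<le> 1" for x
  proof -
    have q0: "q x \<noteq> 0" using q[OF x] by simp
    have dq: "(q has_real_derivative 2 * x - 2 * c) (at x)"
      unfolding q_def by (auto intro!: derivative_eq_intros)
    have dv: "(v has_real_derivative 2 / q x * w x) (at x)"
      unfolding v_def w_def using q0
      by (auto intro!: derivative_eq_intros dq simp: divide_simps)
        (simp add: q_def power2_eq_square algebra_simps)
    have dw: "(w has_real_derivative 2 / q x * (c - (1 - c\<^sup>2) * v x)) (at x)"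
      unfolding w_def v_def using q0
      by (auto intro!: derivative_eq_intros dq simp: divide_simps)
        (simp add: q_def power2_eq_square algebra_simps)
    \<comment> \<open>Differentiating \<open>v ^ n\<close> produces a second factor
      \<open>w\<close>; this relation removes \<open>w\<close> and leaves a polynomial in
      \<open>v\<close> times \<open>2 / q\<close>, that is, a combination of kernels.\<close>
    have w2: "w x * w x = 1 + 2 * c * v x - (1 - c\<^sup>2) * (v x)\<^sup>2"
      unfolding w_def v_def using q0
      by (simp add: divide_simps) (simp add: q_def power2_eq_square algebra_simps)
    have mk: "moment_kernel c k x = 2 / q x * v x ^ k" for k
      by (simp add: moment_kernel_def q_def v_def)
    have "((\<lambda>x. - (v x ^ n * w x)) has_real_derivative
        - (real n * v x ^ (n - 1) * (2 / q x * w x) * w x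
          + v x ^ n * (2 / q x * (c - (1 - c\<^sup>2) * v x)))) (at x)"
      by (auto intro!: derivative_eq_intros dv dw simp: mult_ac)
    also have "real n * v x ^ (n - 1) * (2 / q x * w x) * w x
      = real n * v x ^ (n - 1) * 2 / q x * (1 + 2 * c * v x - (1 - c\<^sup>2) * (v x)\<^sup>2)"
      unfolding w2[symmetric] by simp
    also have "- (\<dots> + v x ^ n * (2 / q x * (c - (1 - c\<^sup>2) * v x))) = R x"
      unfolding R_def mk
      by (cases n) (simp_all add: algebra_simps power2_eq_square add_divide_distrib diff_divide_distrib)
    finally show ?thesis .
  qed
  have "(R has_integral (- (v 1 ^ n * w 1) - (- (v 0 ^ n * w 0)))) {0..1}"
    using der by (intro fundamental_theorem_of_calculus)
      (auto simp: has_real_derivative_iff_has_vector_derivative[symmetric] intro: has_field_derivative_at_within)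
  \<comment> \<open>The boundary value at 1 vanishes since \<open>w 1 = 0\<close>; at 0 one has
    \<open>v 0 = 0\<close> and \<open>w 0 = 1\<close>, so only \<open>n = 0\<close>
    contributes.\<close>
  also have "- (v 1 ^ n * w 1) - (- (v 0 ^ n * w 0)) = (if n = 0 then 1 else 0)"
    by (simp add: w_def v_def q_def)
  finally have "(R has_integral (if n = 0 then 1 else 0)) {0..1}" .
  moreover have "(R has_integral ((real n + 1) * (1 - c\<^sup>2) * moment c (Suc n)
      - (2 * real n + 1) * c * moment c n - real n * moment c (n - 1))) {0..1}"
    unfolding R_def
    by (intro has_integral_diff has_integral_mult_right has_integral_moment_kernel c)
  ultimately show ?thesis by (rule has_integral_unique[symmetric])
qed

text \<open>Completing the square gives
  \<open>q x = (x - cos \<theta>)\<^sup>2 + (sin \<theta>)\<^sup>2\<close>, hence an arctangent as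
  antiderivative. Its branches are read off for \<theta> in (0, pi); the remaining angles follow by
  reflection.\<close>

lemma moment_0:
  assumes "0 < \<theta>" "\<theta> < 2 * pi" "sin \<theta> \<noteq> 0"
  shows "moment (cos \<theta>) 0 = (pi - \<theta>) / sin \<theta>"
proof -
  have main: "moment (cos \<theta>) 0 = (pi - \<theta>) / sin \<theta>" if \<theta>: "0 < \<theta>" "\<theta> < pi" for \<theta>
  proof -
    define s c where "s = sin \<theta>" and "c = cos \<theta>"
    have s: "s > 0" using \<theta> by (simp add: s_def sin_gt_zero)
    have sc: "s\<^sup>2 + c\<^sup>2 = 1" by (simp add: s_def c_def)
    have c1: "c < 1" using \<theta> cos_monotone_0_pi[of 0 \<theta>] by (simp add: c_def)
    have der: "((\<lambda>x. 2 / s * arctan ((x - c) / s)) has_real_derivative moment_kernel c 0 x) (at x)"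
      if "x \<in> {0..1}" for x
    proof -
      have "s\<^sup>2 + (x - c)\<^sup>2 = 1 - 2 * c * x + x\<^sup>2"
        using sc by (simp add: power2_eq_square algebra_simps)
      then have "1 + ((x - c) / s)\<^sup>2 = (1 - 2 * c * x + x\<^sup>2) / s\<^sup>2"
        using s by (simp add: field_simps)
      then have "inverse (1 + ((x - c) / s)\<^sup>2) * (1 / s) = s / (1 - 2 * c * x + x\<^sup>2)"
        using s by (simp add: power2_eq_square)
      moreover have "((\<lambda>x. arctan ((x - c) / s)) has_real_derivative
          inverse (1 + ((x - c) / s)\<^sup>2) * (1 / s)) (at x)"
        using s by (auto intro!: derivative_eq_intros simp: divide_simps)
      ultimately have "((\<lambda>x. 2 / s * arctan ((x - c) / s)) has_real_derivative
          2 / s * (s / (1 - 2 * c * x + x\<^sup>2))) (at x)"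
        by (intro DERIV_cmult) simp
      then show ?thesis
        using s by (simp add: moment_kernel_def)
    qed
    have "(moment_kernel c 0 has_integral
        (2 / s * arctan ((1 - c) / s) - 2 / s * arctan ((0 - c) / s))) {0..1}"
      using der by (intro fundamental_theorem_of_calculus)
        (auto simp: has_real_derivative_iff_has_vector_derivative[symmetric] intro: has_field_derivative_at_within)
    then have "moment c 0 = 2 / s * (arctan ((1 - c) / s) - arctan ((0 - c) / s))"
      by (simp add: moment_def integral_unique right_diff_distrib)
    \<comment> \<open>The half-angle formula
      \<open>tan (\<theta> / 2) = (1 - cos \<theta>) / sin \<theta>\<close>.\<close>
    moreover have "arctan ((1 - c) / s) = \<theta> / 2"
    proof (rule arctan_unique)
      have "s = 2 * sin (\<theta> / 2) * cos (\<theta> / 2)" "1 - c = 2 * (sin (\<theta> / 2))\<^sup>2"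
        using sin_double[of "\<theta> / 2"] cos_double_sin[of "\<theta> / 2"] by (simp_all add: s_def c_def)
      moreover have "sin (\<theta> / 2) > 0" using \<theta> by (intro sin_gt_zero) auto
      ultimately show "tan (\<theta> / 2) = (1 - c) / s"
        by (simp add: tan_def power2_eq_square)
    qed (use \<theta> in auto)
    moreover have "arctan ((0 - c) / s) = \<theta> - pi / 2"
      using \<theta> by (intro arctan_unique) (auto simp: tan_def s_def c_def sin_diff cos_diff)
    ultimately show ?thesis
      by (simp add: s_def c_def field_simps)
  qed
  have "\<theta> \<noteq> pi" using assms by auto
  then consider "\<theta> < pi" | "\<theta> > pi" by linarith
  then show ?thesis
  proof cases
    case 2
    \<comment> \<open>Replacing \<theta> by \<open>2 * pi - \<theta>\<close> keeps the cosine and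
      changes the sign of both \<open>pi - \<theta>\<close> and \<open>sin \<theta>\<close>.\<close>
    have "moment (cos \<theta>) 0 = (pi - (2 * pi - \<theta>)) / sin (2 * pi - \<theta>)"
      using main[of "2 * pi - \<theta>"] assms 2 by (simp add: cos_diff)
    also have "\<dots> = (pi - \<theta>) / sin \<theta>"
      using assms(3) by (simp add: sin_diff divide_simps)
    finally show ?thesis .
  qed (use main assms in auto)
qed

section \<open>Termwise integration of the series\<close>

lemma continuous_on_powser:
  assumes "summable (\<lambda>n. norm (a n))"
  shows "continuous_on (cball 0 1) (powser a)"
proof -
  have "uniform_limit (cball 0 1) (\<lambda>n z. \<Sum>i<n. a i * z ^ i) (powser a) sequentially"
    unfolding powser_def
    by (rule Weierstrass_m_test[OF _ assms]) (auto simp: norm_mult norm_power intro!: mult_right_le_one_le power_le_one)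
  then show ?thesis
    by (rule uniform_limit_theorem[rotated]) (auto intro!: continuous_intros always_eventually)
qed

text \<open>The series of \<open>dlog_coeff a\<close> is an antiderivative on (0, 1). Its
  coefficients are absolutely summable, so it is continuous up to the endpoint 1, where its value is
  the claimed sum.\<close>

lemma has_integral_powser_div:
  assumes "inverse_sqrt_bounded a"
  shows "((\<lambda>x. powser a (of_real x) / of_real x) has_integral suminf (dlog_coeff a)) {0<..<1}"
proof -
  let ?b = "dlog_coeff a"
  have "((\<lambda>x. powser a (of_real x) / of_real x) has_integral
      powser ?b (of_real 1) - powser ?b (of_real 0)) {0..1}"
  proof (rule fundamental_theorem_of_calculus_interior)
    show "continuous_on {0..1} (\<lambda>x. powser ?b (of_real x))"
      by (rule continuous_on_compose2[OF continuous_on_powser[OF summable_norm_dlog_coeff[OF assms]]])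
        (auto intro!: continuous_intros)
    fix x :: real assume x: "x \<in> {0<..<1}"
    have "complex_of_real x * powser (diffs ?b) (of_real x) = powser a (of_real x)"
      using x assms by (intro powser_diffs_dlog_coeff Bseq_inverse_sqrt_bounded inverse_sqrt_bounded_0) auto
    then have "powser (diffs ?b) (of_real x) = powser a (of_real x) / of_real x"
      using x by (auto simp: field_simps)
    moreover have "(powser ?b has_field_derivative powser (diffs ?b) (of_real x)) (at (of_real x))"
      using x assms by (intro DERIV_powser Bseq_dlog_coeff Bseq_inverse_sqrt_bounded) auto
    ultimately show "((\<lambda>x. powser ?b (of_real x)) has_vector_derivative powser a (of_real x) / of_real x) (at x)"
      using has_vector_derivative_real_field by metis
  qed simp
  then show ?thesis
    by (simp add: has_integral_Icc_iff_Ioo powser_def[of _ 1]) (simp add: dlog_coeff_def cong: suminf_cong)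
qed

text \<open>Each term \<open>C n * u ^ n / x\<close> integrates to a multiple of a moment. All terms
  are nonnegative, so the partial sums are dominated by their limit, which is integrable by
  \<open>has_integral_powser_div\<close>; dominated convergence exchanges sum and integral. The
  condition \<open>C 0 = 0\<close> permits starting at index 1.\<close>

lemma sums_moment:
  assumes c: "c < 1" and C: "\<And>n. 0 \<le> C n" "C 0 = 0"
    and a: "inverse_sqrt_bounded a"
    and eq: "\<And>x. 0 < x \<Longrightarrow> x < 1 \<Longrightarrow>
      (\<lambda>n. complex_of_real (C n * unit_kernel c x ^ n)) sums powser a (of_real x)"
  shows "(\<lambda>n. complex_of_real (C (Suc n) * (1 - c) ^ Suc n * moment c n)) sums suminf (dlog_coeff a)"
proof -
  define f where "f = (\<lambda>k x. \<Sum>n<k. C (Suc n) * (1 - c) ^ Suc n * moment_kernel c n x)"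
  define g where "g = (\<lambda>x::real. powser a (of_real x) / of_real x)"
  have f_eq: "f k x = (\<Sum>n<k. C (Suc n) * unit_kernel c x ^ Suc n / x)" if "x \<noteq> 0" for k x
    unfolding f_def by (intro sum.cong refl) (simp only: mult.assoc unit_kernel_power_Suc[OF that, symmetric] times_divide_eq_right)
  have int_f: "((\<lambda>x. complex_of_real (f k x)) has_integral
      of_real (\<Sum>n<k. C (Suc n) * (1 - c) ^ Suc n * moment c n)) {0<..<1}" for k
    unfolding has_integral_Icc_iff_Ioo[symmetric] f_def
    by (intro has_integral_of_real has_integral_sum has_integral_mult_right has_integral_moment_kernel c) auto
  have int_g: "(g has_integral suminf (dlog_coeff a)) {0<..<1}"
    unfolding g_def by (rule has_integral_powser_div[OF a])
  have sums_g: "(\<lambda>n. complex_of_real (C (Suc n) * unit_kernel c x ^ Suc n / x)) sums g x"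
    if x: "x \<in> {0<..<1}" for x
  proof -
    have "(\<lambda>n. complex_of_real (C (Suc n) * unit_kernel c x ^ Suc n)) sums powser a (of_real x)"
      using eq[of x] x C(2) by (subst sums_Suc_iff) simp
    from sums_divide[OF this, of "of_real x"] show ?thesis by (simp add: g_def)
  qed
  have "(\<lambda>k. integral {0<..<1} (\<lambda>x. complex_of_real (f k x))) \<longlonglongrightarrow> integral {0<..<1} g"
  proof (rule dominated_convergence)
    show "(\<lambda>x. Re (g x)) integrable_on {0<..<1}"
      using has_integral_Re[OF int_g] by (auto simp: integrable_on_def)
    fix k and x :: real assume x: "x \<in> {0<..<1}"
    define t where "t = (\<lambda>n. C (Suc n) * unit_kernel c x ^ Suc n / x)"
    have nonneg: "0 \<le> t n" for n
      using x C unit_kernel_bounds[OF c, of x] by (simp add: t_def)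
    have ft: "f k x = sum t {..<k}"
    proof -
      have "x \<noteq> 0" using x by simp
      then show ?thesis unfolding t_def by (rule f_eq)
    qed
    have "t sums Re (g x)"
      using sums_Re[OF sums_g[OF x]] by (simp add: t_def)
    then have "f k x \<le> Re (g x)"
      unfolding ft using nonneg sum_le_suminf[of t "{..<k}"] by (simp add: sums_iff)
    moreover have "0 \<le> f k x"
      unfolding ft using nonneg by (intro sum_nonneg)
    ultimately show "norm (complex_of_real (f k x)) \<le> Re (g x)" by simp
  next
    fix x :: real assume x: "x \<in> {0<..<1}"
    then have "x \<noteq> 0" by simp
    then show "(\<lambda>k. complex_of_real (f k x)) \<longlonglongrightarrow> g x"
      using sums_g[OF x] by (simp only: f_eq[OF \<open>x \<noteq> 0\<close>] sums_def of_real_sum)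
  qed (use int_f in \<open>auto simp: integrable_on_def\<close>)
  then show ?thesis
    by (simp only: integral_unique[OF int_f] integral_unique[OF int_g] sums_def of_real_sum)
qed

section \<open>Pullback of multiple harmonic generating series at roots of unity\<close>

lemma Bseq_polylog_space:
  assumes "a \<in> polylog_space N w" "0 < N"
  shows "Bseq a"
  using assms(1)
proof induction
  case (base ks \<eta>s)
  then show ?case
    using assms(2) norm_eq_one_if_root by (intro BseqI'[of _ 1] norm_polylog_coeff_le_one) auto
qed (auto intro: Bseq_plus Bseq_cmult)

context
  fixes \<mu> :: complex and N :: nat
  assumes root: "\<mu> ^ N = 1" and N: "0 < N" and \<mu>_ne_1: "\<mu> \<noteq> 1"
begin

lemma norm_root: "norm \<mu> = 1"
  using root N by (rule norm_eq_one_if_root)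

lemma cnj_root: "cnj \<mu> ^ N = 1"
  using root by (metis complex_cnj_one complex_cnj_power)

text \<open>The coefficients found in \<open>powser_dlog_coeff_unit_kernel\<close>: the pulled-back
  form has integer coefficients and poles governed by \<open>N\<close>th roots of unity, so one
  integration raises the weight by one and stays rational.\<close>

lemma dlog_step_polylog_space:
  assumes "a \<in> polylog_space N w" "0 < w"
  shows "(\<lambda>n. dlog_coeff a n + (geometric_coeff \<mu> a n + geometric_coeff (cnj \<mu>) a n))
    \<in> polylog_space N (Suc w)"
  using assms root cnj_root
  by (intro polylog_space.add dlog_coeff_polylog_space geometric_coeff_polylog_space)

lemma geometric_step_polylog_space:
  assumes "a \<in> polylog_space N w"
  shows "(\<lambda>n. 2 * geometric_coeff 1 a n + - 1 * (geometric_coeff \<mu> a n + geometric_coeff (cnj \<mu>) a n))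
    \<in> polylog_space N (Suc w)"
  using assms root cnj_root
  by (intro polylog_space.add polylog_space.scale[where q = 2, simplified] geometric_coeff_polylog_space
      polylog_space.scale[where q = "- 1", unfolded of_rat_minus of_rat_1]) auto

text \<open>Outer induction adds an entry to the composition, inner induction raises that entry from
  1. Creating the entry is an integration against \<open>du / (1 - u)\<close>, raising it one
  against \<open>du / u\<close>, and each is pulled back by the corresponding step.\<close>

lemma powser_harmonic_unit_kernel:
  assumes "composition ks"
  shows "\<exists>a \<in> polylog_space N (sum_list ks). \<forall>x. 0 \<le> x \<longrightarrow> x < 1 \<longrightarrow>
    powser (polylog_coeff ks (replicate (length ks) 1)) (of_real (unit_kernel (Re \<mu>) x)) = powser a (of_real x)"
  using assms
proof (induction ks)
  case Nil
  have "polylog_coeff [] [] \<in> polylog_space N 0"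
    by (rule polylog_space.base) (auto simp: composition_def)
  then show ?case
    by (intro bexI[of _ "polylog_coeff [] []"])
      (simp_all add: powser_polylog_coeff_Nil del: polylog_coeff.simps)
next
  case (Cons k ks)
  let ?C = "\<lambda>k. polylog_coeff (k # ks) (1 # replicate (length ks) 1)"
  have comp: "composition ks" "0 < k" using Cons.prems by (auto simp: composition_def)
  have BC: "Bseq (polylog_coeff ks (replicate (length ks) 1))"
    if "composition ks" for ks
    by (rule BseqI'[of _ 1], rule norm_polylog_coeff_le_one) (use that in auto)
  note unit = norm_root \<mu>_ne_1 refl
  from comp(2) have "\<exists>a \<in> polylog_space N (k + sum_list ks). \<forall>x. 0 \<le> x \<longrightarrow> x < 1 \<longrightarrow>
    powser (?C k) (of_real (unit_kernel (Re \<mu>) x)) = powser a (of_real x)"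
  proof (induction k rule: nat_induct_non_zero)
    case 1
    from Cons.IH[OF comp(1)] obtain a where a: "a \<in> polylog_space N (sum_list ks)"
      and eq: "\<And>x. 0 \<le> x \<Longrightarrow> x < 1 \<Longrightarrow>
        powser (polylog_coeff ks (replicate (length ks) 1)) (of_real (unit_kernel (Re \<mu>) x)) = powser a (of_real x)"
      by blast
    have "?C 1 = geometric_coeff 1 (polylog_coeff ks (replicate (length ks) 1))"
      by (simp add: geometric_coeff_def fun_eq_iff)
    then show ?case
      using powser_geometric_coeff_unit_kernel[OF unit BC[OF comp(1)] Bseq_polylog_space[OF a N] eq]
        geometric_step_polylog_space[OF a] by fastforce
  next
    case (Suc k)
    then obtain a where a: "a \<in> polylog_space N (k + sum_list ks)"
      and eq: "\<And>x. 0 \<le> x \<Longrightarrow> x < 1 \<Longrightarrow>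
        powser (?C k) (of_real (unit_kernel (Re \<mu>) x)) = powser a (of_real x)"
      by blast
    have pos: "0 < k + sum_list ks" using Suc by simp
    have "?C (Suc k) = dlog_coeff (?C k)" "?C k 0 = 0"
      using Suc by (auto simp: dlog_coeff_def fun_eq_iff)
    moreover have "Bseq (?C k)"
      using BC[of "k # ks"] comp Suc by (auto simp: composition_def)
    \<comment> \<open>Integration against \<open>dx / x\<close> requires a vanishing constant term,
      which positive weight supplies.\<close>
    moreover have "a 0 = 0"
      using a pos N by (intro inverse_sqrt_bounded_0 inverse_sqrt_bounded_polylog_space)
    ultimately show ?case
      using powser_dlog_coeff_unit_kernel[OF unit, of "?C k" a, OF _ _ Bseq_polylog_space[OF a N] _ eq]
        dlog_step_polylog_space[OF a pos] by fastforce
  qed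
  then show ?case by (simp del: polylog_coeff.simps)
qed

lemma sums_harmonic_moment:
  assumes l: "0 < l" and ks: "composition ks" and a: "inverse_sqrt_bounded a"
    and eq: "\<And>x. 0 \<le> x \<Longrightarrow> x < 1 \<Longrightarrow>
      powser (polylog_coeff (l # ks) (replicate (Suc (length ks)) 1)) (of_real (unit_kernel (Re \<mu>) x))
        = powser a (of_real x)"
  shows "(\<lambda>n. complex_of_real (multiple_harmonic_sum n ks / real (Suc n) ^ l
      * (1 - Re \<mu>) ^ Suc n * moment (Re \<mu>) n)) sums suminf (dlog_coeff a)"
proof -
  \<comment> \<open>At \<open>n = 0\<close> the truncated \<open>n - 1\<close> is harmless: the
    denominator \<open>0 ^ l\<close> makes the value 0 since \<open>l > 0\<close>.\<close>
  define C where "C = (\<lambda>n. multiple_harmonic_sum (n - 1) ks / real n ^ l)"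
  have C: "complex_of_real (C n) = polylog_coeff (l # ks) (replicate (Suc (length ks)) 1) n" for n
    using l multiple_harmonic_sum_polylog_coeff[OF ks, of "n - 1" l]
    by (cases "n = 0") (simp_all add: C_def)
  have Re: "Re \<mu> < 1"
    using norm_root \<mu>_ne_1 by (rule Re_lt_one) simp
  have "(\<lambda>n. complex_of_real (C (Suc n) * (1 - Re \<mu>) ^ Suc n * moment (Re \<mu>) n)) sums suminf (dlog_coeff a)"
  proof (rule sums_moment[OF Re _ _ a])
    show "0 \<le> C n" for n
      by (auto simp: C_def multiple_harmonic_sum_def intro!: divide_nonneg_nonneg sum_nonneg prod_nonneg)
    show "C 0 = 0" using l by (simp add: C_def)
    fix x :: real assume x: "0 < x" "x < 1"
    have B: "Bseq (polylog_coeff (l # ks) (replicate (Suc (length ks)) 1))"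
      using l ks by (intro BseqI'[of _ 1] norm_polylog_coeff_le_one) (auto simp: composition_def)
    have "summable (\<lambda>n. polylog_coeff (l # ks) (replicate (Suc (length ks)) 1) n
        * complex_of_real (unit_kernel (Re \<mu>) x) ^ n)"
      using unit_kernel_bounds[OF Re, of x] x by (intro summable_powser[OF B]) auto
    from summable_sums[OF this] eq[of x] x
    show "(\<lambda>n. complex_of_real (C n * unit_kernel (Re \<mu>) x ^ n)) sums powser a (of_real x)"
      by (simp only: powser_def of_real_mult of_real_power C less_imp_le)
  qed
  then show ?thesis by (simp add: C_def)
qed

end

section \<open>Convergent values, the zeta function, and identification of the sequence with the
  moments\<close>

text \<open>A leading exponent of at least 2 exhibits the sequence as \<open>dlog_coeff\<close> of a
  sequence decaying like \<open>1 / sqrt n\<close>.\<close>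

lemma sums_Li:
  assumes "composition (k # ks)" "2 \<le> k" "length \<eta>s = Suc (length ks)" "\<forall>\<eta>\<in>set \<eta>s. norm \<eta> = 1"
  shows "polylog_coeff (k # ks) \<eta>s sums Li (k # ks) \<eta>s"
proof -
  obtain k' where k: "k = Suc k'" "0 < k'" using assms(2) by (cases k) auto
  have "summable (dlog_coeff (polylog_coeff (k' # ks) \<eta>s))"
    using assms k
    by (intro summable_norm_cancel[OF summable_norm_dlog_coeff] inverse_sqrt_bounded_polylog_coeff)
      (auto simp: composition_def)
  then have "summable (polylog_coeff (k # ks) \<eta>s)"
    using assms k by (simp add: dlog_coeff_polylog_coeff)
  then show ?thesis
    using Li_eq_suminf_polylog_coeff(2)[of "k # ks" \<eta>s] assms by (simp add: sums_iff)
qed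

lemma zeta_eq_Li:
  assumes "2 \<le> k" shows "zeta (of_nat k) = Li [k] [1]"
proof -
  have "polylog_coeff [k] [1] sums Li [k] [1]"
    using assms by (intro sums_Li) (auto simp: composition_def)
  then have "(\<lambda>n. polylog_coeff [k] [1] (Suc n)) sums Li [k] [1]"
    using assms by (subst sums_Suc_iff) simp
  moreover have "(\<Sum>m<Suc n. if m = 0 then 1 else 0) = (1::complex)" for n
    by (simp add: sum.lessThan_Suc_shift)
  ultimately have "(\<lambda>n. 1 / of_nat (Suc n) ^ k) sums Li [k] [1]"
    by (simp del: of_nat_Suc sum.lessThan_Suc)
  then show ?thesis
    by (simp add: zeta_def sums_iff powr_nat' del: of_nat_Suc)
qed

text \<open>For \<open>c\<^sup>2 = 1\<close> the leading coefficient vanishes and the recurrence has to be read one index higher.\<close>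
lemma moment_unique:
  assumes c: "c < 1" "c \<noteq> 0 \<or> c\<^sup>2 \<noteq> 1"
    and F: "F 1 = moment c 0" "F 2 = moment c 1"
    and rec: "\<forall>n\<ge>2. real n * (1 - c\<^sup>2) * F (n + 1) - (2 * real n - 1) * c * F n
                 - (real n - 1) * F (n - 1) = 0"
  shows "F (Suc n) = moment c n"
proof (induction n rule: less_induct)
  case (less n)
  consider "n = 0" | "n = 1" | m where "n = Suc (Suc m)"
    by (metis One_nat_def not0_implies_Suc)
  then show ?case
  proof cases
    case 3
    have F': "F (Suc m) = moment c m" "F (Suc (Suc m)) = moment c (Suc m)"
      using less 3 by auto
    show ?thesis
    proof (cases "c\<^sup>2 = 1")
      case True
      have "(2 * real m + 5) * c * F (Suc (Suc (Suc m))) = - ((real m + 2) * F (Suc (Suc m)))"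
        using rec[rule_format, of "Suc (Suc (Suc m))"] True by (simp add: algebra_simps)
      moreover have "(2 * real m + 5) * c * moment c (Suc (Suc m)) = - ((real m + 2) * moment c (Suc m))"
        using moment_recurrence[OF c(1), of "Suc (Suc m)"] True by (simp add: algebra_simps)
      ultimately have "(2 * real m + 5) * c * F (Suc (Suc (Suc m))) = (2 * real m + 5) * c * moment c (Suc (Suc m))"
        using F' by simp
      moreover have "(2 * real m + 5) * c \<noteq> 0"
        using c True by (auto simp: add_eq_0_iff)
      ultimately show ?thesis unfolding 3 using mult_left_cancel by blast
    next
      case False
      have "(real m + 2) * (1 - c\<^sup>2) * F (Suc (Suc (Suc m)))
          = (2 * real m + 3) * c * F (Suc (Suc m)) + (real m + 1) * F (Suc m)"
        using rec[rule_format, of "Suc (Suc m)"] by (simp add: algebra_simps)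
      moreover have "(real m + 2) * (1 - c\<^sup>2) * moment c (Suc (Suc m))
          = (2 * real m + 3) * c * moment c (Suc m) + (real m + 1) * moment c m"
        using moment_recurrence[OF c(1), of "Suc m"] by (simp add: algebra_simps)
      ultimately have "(real m + 2) * (1 - c\<^sup>2) * F (Suc (Suc (Suc m)))
          = (real m + 2) * (1 - c\<^sup>2) * moment c (Suc (Suc m))"
        using F' by simp
      moreover have "(real m + 2) * (1 - c\<^sup>2) \<noteq> 0"
        using False by (auto simp: add_eq_0_iff)
      ultimately show ?thesis unfolding 3 using mult_left_cancel by blast
    qed
  qed (use F in \<open>simp_all add: numeral_2_eq_2\<close>)
qed

lemma geometric_coeff_add:
  "geometric_coeff \<eta> (\<lambda>n. a n + b n) n = geometric_coeff \<eta> a n + geometric_coeff \<eta> b n"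
  by (simp add: geometric_coeff_def add_divide_distrib sum.distrib ring_distribs)

lemma geometric_coeff_cmult:
  "geometric_coeff \<eta> (\<lambda>n. k * a n) n = k * geometric_coeff \<eta> a n"
  by (simp add: geometric_coeff_def sum_distrib_left mult_ac)

lemma dlog_coeff_add: "dlog_coeff (\<lambda>n. a n + b n) n = dlog_coeff a n + dlog_coeff b n"
  by (simp add: dlog_coeff_def add_divide_distrib)

lemma dlog_coeff_cmult: "dlog_coeff (\<lambda>n. k * a n) n = k * dlog_coeff a n"
  by (simp add: dlog_coeff_def)

section \<open>The general series and the two explicit evaluations\<close>

theorem theorem4p6:
  fixes N j :: nat and \<theta> :: real and F :: "nat \<Rightarrow> real" and \<mu> :: complex
  assumes "N \<ge> 2" and "1 \<le> j" and "j < N"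
    and "\<theta> = 2 * real j * pi / real N"
    and "F 1 = (if 2 * j = N then 1 else (pi - \<theta>) / sin \<theta>)"
    and "F 2 = (if 2 * j = N then 1 / 3 else (cos \<theta> * F 1 + 1) / (sin \<theta>)\<^sup>2)"
    and "\<forall>n\<ge>2. real n * (sin \<theta>)\<^sup>2 * F (n + 1) - (2 * real n - 1) * cos \<theta> * F n
                 - (real n - 1) * F (n - 1) = 0"
    and "\<mu> = exp (\<i> * complex_of_real \<theta>)"
  shows "(\<forall>l ks. 0 < l \<longrightarrow> composition ks \<longrightarrow>
            summable (\<lambda>n. multiple_harmonic_sum n ks / real (Suc n) ^ l
                            * (1 - cos \<theta>) ^ Suc n * F (Suc n)) \<and>
            complex_of_real (\<Sum>n. multiple_harmonic_sum n ks / real (Suc n) ^ l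
                            * (1 - cos \<theta>) ^ Suc n * F (Suc n))
              \<in> CMZV N (sum_list ks + l + 1))
       \<and> (\<lambda>n. complex_of_real ((1 - cos \<theta>) ^ Suc n * F (Suc n) / real (Suc n)))
            sums (2 * zeta 2 - Li [2] [\<mu>] - Li [2] [cnj \<mu>])
       \<and> 2 * zeta 2 - Li [2] [\<mu>] - Li [2] [cnj \<mu>] \<in> CMZV N 2
       \<and> (\<lambda>n. complex_of_real ((1 - cos \<theta>) ^ Suc n * F (Suc n) / real (Suc n) ^ 2))
            sums ((\<Sum>\<eta>\<leftarrow>[\<mu>, cnj \<mu>]. 2 * Li [2, 1] [\<eta>, cnj \<eta>] - Li [2, 1] [\<eta>, 1]
                                      - Li [2, 1] [\<eta>, (cnj \<eta>)\<^sup>2])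
                  + 2 * zeta 3 - Li [3] [\<mu>] - Li [3] [cnj \<mu>])
       \<and> (\<Sum>\<eta>\<leftarrow>[\<mu>, cnj \<mu>]. 2 * Li [2, 1] [\<eta>, cnj \<eta>] - Li [2, 1] [\<eta>, 1]
                                      - Li [2, 1] [\<eta>, (cnj \<eta>)\<^sup>2])
                  + 2 * zeta 3 - Li [3] [\<mu>] - Li [3] [cnj \<mu>] \<in> CMZV N 3"
proof -
  have N: "0 < N" using assms(1) by simp
  have \<theta>: "0 < \<theta>" "\<theta> < 2 * pi"
    using assms(2,3) N unfolding assms(4) by (simp_all add: pos_divide_less_eq)
  have \<mu>_cis: "\<mu> = cis \<theta>"
    using assms(8) by (simp add: cis_conv_exp)
  have Re: "Re \<mu> = cos \<theta>" by (simp add: \<mu>_cis)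
  have root: "\<mu> ^ N = 1"
  proof -
    have "\<mu> ^ N = cis (real N * \<theta>)"
      unfolding \<mu>_cis by (rule Complex.DeMoivre)
    also have "real N * \<theta> = 2 * pi * real j"
      using N by (simp add: assms(4))
    also have "cis \<dots> = 1"
      by (rule cis_multiple_2pi) simp
    finally show ?thesis .
  qed
  have "0 < sin (\<theta> / 2)"
    using \<theta> by (intro sin_gt_zero) auto
  then have c: "cos \<theta> < 1"
    using cos_double_sin[of "\<theta> / 2"] by simp
  then have \<mu>_ne_1: "\<mu> \<noteq> 1" using Re by auto
  note root_facts = root N \<mu>_ne_1
  have norm_\<mu>: "norm \<mu> = 1" by (rule norm_root[OF root_facts])
  have s: "1 - (cos \<theta>)\<^sup>2 = (sin \<theta>)\<^sup>2" by (simp add: sin_squared_eq)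
  have F: "F (Suc n) = moment (cos \<theta>) n" for n
  proof (rule moment_unique[OF c])
    have m0: "(sin \<theta>)\<^sup>2 * moment (cos \<theta>) 1 - cos \<theta> * moment (cos \<theta>) 0 = 1"
      using moment_recurrence[OF c, of 0, unfolded s] by simp
    have m1: "2 * (sin \<theta>)\<^sup>2 * moment (cos \<theta>) 2 - 3 * cos \<theta> * moment (cos \<theta>) 1 - moment (cos \<theta>) 0 = 0"
      using moment_recurrence[OF c, of 1, unfolded s] by (simp add: numeral_2_eq_2)
    have "F 1 = moment (cos \<theta>) 0 \<and> F 2 = moment (cos \<theta>) 1"
    proof (cases "2 * j = N")
      \<comment> \<open>Here \<theta> is \<open>pi\<close>: the terms with
        \<open>sin \<theta>\<close> drop out of \<open>m0\<close> and \<open>m1\<close>, which then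
        give the values 1 and 1/3.\<close>
      case True
      then have "real N = 2 * real j" by auto
      then have "\<theta> = pi" using assms(2) by (simp add: assms(4))
      then show ?thesis using m0 m1 True assms(5,6) by simp
    next
      case False
      \<comment> \<open>In (0, 2 pi) the sine vanishes only at \<open>pi\<close>, which would mean
        \<open>2 * j = N\<close>.\<close>
      have sin: "sin \<theta> \<noteq> 0"
      proof
        assume "sin \<theta> = 0"
        then obtain k :: int where "\<theta> = real_of_int k * pi" by (auto simp: sin_zero_iff_int2)
        with \<theta> have "0 < k" "k < 2" by (auto simp: zero_less_mult_iff)
        then have "k = 1" by simp
        with \<open>\<theta> = real_of_int k * pi\<close> assms(4) N have "real N = 2 * real j" by (simp add: field_simps)
        then have "real N = real (2 * j)" by simp
        with False show False by linarith
      qed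
      with m0 have "moment (cos \<theta>) 1 = (cos \<theta> * moment (cos \<theta>) 0 + 1) / (sin \<theta>)\<^sup>2"
        by (simp add: field_simps)
      then show ?thesis using assms(5,6) False moment_0[OF \<theta> sin] by simp
    qed
    then show "F 1 = moment (cos \<theta>) 0" "F 2 = moment (cos \<theta>) 1" by auto
  qed (use assms(7) in \<open>auto simp: s\<close>)
  \<comment> \<open>Stated for an arbitrary pulled-back sequence \<open>a\<close>: the general claim
    uses one known only to exist, the explicit formulas use \<open>a1\<close> and
    \<open>a2\<close>.\<close>
  have series: "(\<lambda>n. complex_of_real (multiple_harmonic_sum n ks / real (Suc n) ^ l
      * (1 - cos \<theta>) ^ Suc n * F (Suc n))) sums suminf (dlog_coeff a)
      \<and> suminf (dlog_coeff a) \<in> CMZV N (sum_list ks + l + 1)"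
    if l: "0 < l" and ks: "composition ks" and a: "a \<in> polylog_space N (l + sum_list ks)"
      and eq: "\<And>x. 0 \<le> x \<Longrightarrow> x < 1 \<Longrightarrow> powser (polylog_coeff (l # ks) (replicate (Suc (length ks)) 1))
        (of_real (unit_kernel (Re \<mu>) x)) = powser a (of_real x)" for l ks a
  proof -
    have pos: "0 < l + sum_list ks" using l by simp
    show ?thesis
      using sums_harmonic_moment[OF root_facts l ks inverse_sqrt_bounded_polylog_space[OF a pos N] eq]
        suminf_dlog_coeff_in_CMZV[OF a pos N]
      by (simp add: F Re add.commute)
  qed
  have general: "summable (\<lambda>n. multiple_harmonic_sum n ks / real (Suc n) ^ l * (1 - cos \<theta>) ^ Suc n * F (Suc n)) \<and>
      complex_of_real (\<Sum>n. multiple_harmonic_sum n ks / real (Suc n) ^ l * (1 - cos \<theta>) ^ Suc n * F (Suc n))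
        \<in> CMZV N (sum_list ks + l + 1)" if "0 < l" "composition ks" for l ks
  proof -
    have "composition (l # ks)" using that by (simp add: composition_def)
    from powser_harmonic_unit_kernel[OF root_facts this] obtain a where
      "a \<in> polylog_space N (l + sum_list ks)"
      "\<And>x. 0 \<le> x \<Longrightarrow> x < 1 \<Longrightarrow> powser (polylog_coeff (l # ks) (replicate (Suc (length ks)) 1))
        (of_real (unit_kernel (Re \<mu>) x)) = powser a (of_real x)" by auto
    from series[OF that this] obtain S where S: "(\<lambda>n. complex_of_real (multiple_harmonic_sum n ks / real (Suc n) ^ l
      * (1 - cos \<theta>) ^ Suc n * F (Suc n))) sums S" "S \<in> CMZV N (sum_list ks + l + 1)" by blast
    have sum: "summable (\<lambda>n. multiple_harmonic_sum n ks / real (Suc n) ^ l * (1 - cos \<theta>) ^ Suc n * F (Suc n))"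
      using sums_summable[OF S(1)] by (simp only: summable_of_real_iff)
    from S(2) sum show ?thesis
      unfolding sums_unique2[OF S(1) sums_of_real[OF summable_sums[OF sum]]] by (intro conjI)
  qed
  \<comment> \<open>\<open>P \<eta>\<close> holds the coefficients of
    \<open>- ln (1 - \<eta> * x)\<close>. Then \<open>a1\<close> and \<open>a2\<close> are the
    coefficients in \<open>x\<close> of the classical logarithm \<open>- ln (1 - u)\<close> and
    dilogarithm of \<open>u\<close>, obtained by one geometric step followed by one dlog
    step.\<close>
  define P where "P = (\<lambda>\<eta>. polylog_coeff [1] [\<eta>])"
  define a1 where "a1 = (\<lambda>n. 2 * P 1 n + - 1 * (P \<mu> n + P (cnj \<mu>) n))"
  define a2 where "a2 = (\<lambda>n. dlog_coeff a1 n + (geometric_coeff \<mu> a1 n + geometric_coeff (cnj \<mu>) a1 n))"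
  have P: "P = (\<lambda>\<eta>. geometric_coeff \<eta> (polylog_coeff [] []))"
    by (simp only: P_def geometric_coeff_polylog_coeff_Nil)
  have nil: "polylog_coeff [] [] \<in> polylog_space N 0"
    by (rule polylog_space.base) (auto simp: composition_def)
  have a1: "a1 \<in> polylog_space N 1"
    using geometric_step_polylog_space[OF root_facts nil] by (simp only: a1_def P One_nat_def)
  have a2: "a2 \<in> polylog_space N 2"
    using dlog_step_polylog_space[OF root_facts a1] by (simp add: a2_def numeral_2_eq_2)
  have eq1: "powser (polylog_coeff [1] [1]) (of_real (unit_kernel (Re \<mu>) x)) = powser a1 (of_real x)"
    if "0 \<le> x" "x < 1" for x
    using powser_geometric_coeff_unit_kernel[OF norm_\<mu> \<mu>_ne_1 refl Bseq_polylog_space[OF nil N]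
      Bseq_polylog_space[OF nil N] _ that] powser_polylog_coeff_Nil
    by (simp only: a1_def P geometric_coeff_polylog_coeff_Nil[of 1, symmetric])
  have one: "polylog_coeff [1] [1] \<in> polylog_space N 1"
    by (rule polylog_space.base) (auto simp: composition_def)
  have zero: "a 0 = 0" if "a \<in> polylog_space N 1" for a
    using inverse_sqrt_bounded_0[OF inverse_sqrt_bounded_polylog_space[OF that _ N]] by simp
  have eq2: "powser (polylog_coeff [2] [1]) (of_real (unit_kernel (Re \<mu>) x)) = powser a2 (of_real x)"
    if "0 \<le> x" "x < 1" for x
    using powser_dlog_coeff_unit_kernel[OF norm_\<mu> \<mu>_ne_1 refl Bseq_polylog_space[OF one N] zero[OF one]
      Bseq_polylog_space[OF a1 N] zero[OF a1] eq1 that] dlog_coeff_polylog_coeff[of "[1]" 1 "[]"]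
    by (simp add: a2_def numeral_2_eq_2 del: polylog_coeff.simps)
  have inv: "inverse \<mu> = cnj \<mu>" "inverse (cnj \<mu>) = \<mu>"
    using \<mu>_cis by (auto simp: cis_cnj)
  have LiP: "dlog_coeff (P \<eta>) sums Li [2] [\<eta>]" "dlog_coeff (dlog_coeff (P \<eta>)) sums Li [3] [\<eta>]"
    if "norm \<eta> = 1" for \<eta>
    using that sums_Li[of 2 "[]" "[\<eta>]"] sums_Li[of 3 "[]" "[\<eta>]"]
    by (simp_all add: P_def dlog_coeff_polylog_coeff composition_def eval_nat_numeral del: polylog_coeff.simps)
  \<comment> \<open>The second root is kept as \<open>\<zeta> * inverse \<eta>\<close>, which
    \<open>inv\<close> later turns into conjugates.\<close>
  have LiPP: "dlog_coeff (geometric_coeff \<eta> (P \<zeta>)) sums Li [2, 1] [\<eta>, \<zeta> * inverse \<eta>]"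
    if "norm \<eta> = 1" "norm \<zeta> = 1" for \<eta> \<zeta>
    using that sums_Li[of 2 "[1]" "[\<eta>, \<zeta> * inverse \<eta>]"]
    by (simp add: P_def geometric_coeff_polylog_coeff_Cons dlog_coeff_polylog_coeff composition_def
        eval_nat_numeral norm_divide divide_inverse[symmetric] del: polylog_coeff.simps)
  have zeta: "zeta 2 = Li [2] [1]" "zeta 3 = Li [3] [1]"
    using zeta_eq_Li[of 2] zeta_eq_Li[of 3] by simp_all
  let ?S1 = "2 * zeta 2 - Li [2] [\<mu>] - Li [2] [cnj \<mu>]"
  let ?S2 = "(\<Sum>\<eta>\<leftarrow>[\<mu>, cnj \<mu>]. 2 * Li [2, 1] [\<eta>, cnj \<eta>] - Li [2, 1] [\<eta>, 1] - Li [2, 1] [\<eta>, (cnj \<eta>)\<^sup>2])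
    + 2 * zeta 3 - Li [3] [\<mu>] - Li [3] [cnj \<mu>]"
  have "dlog_coeff a1 = (\<lambda>n. 2 * dlog_coeff (P 1) n + - 1 * (dlog_coeff (P \<mu>) n + dlog_coeff (P (cnj \<mu>)) n))"
    unfolding a1_def by (simp only: dlog_coeff_add dlog_coeff_cmult fun_eq_iff) simp
  moreover have "\<dots> sums (2 * Li [2] [1] + - 1 * (Li [2] [\<mu>] + Li [2] [cnj \<mu>]))"
    by (intro sums_add sums_mult LiP) (simp_all add: norm_\<mu>)
  ultimately have S1: "suminf (dlog_coeff a1) = ?S1"
    by (simp add: sums_iff zeta)
  have dd: "dlog_coeff (dlog_coeff a1) n = 2 * dlog_coeff (dlog_coeff (P 1)) n
      + - 1 * (dlog_coeff (dlog_coeff (P \<mu>)) n + dlog_coeff (dlog_coeff (P (cnj \<mu>))) n)" for n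
    by (simp add: a1_def dlog_coeff_def add_divide_distrib diff_divide_distrib)
  have dg: "dlog_coeff (geometric_coeff \<eta> a1) n = 2 * dlog_coeff (geometric_coeff \<eta> (P 1)) n
      + - 1 * (dlog_coeff (geometric_coeff \<eta> (P \<mu>)) n + dlog_coeff (geometric_coeff \<eta> (P (cnj \<mu>))) n)" for \<eta> n
    unfolding a1_def geometric_coeff_add geometric_coeff_cmult dlog_coeff_def
    by (simp add: add_divide_distrib diff_divide_distrib)
  have "dlog_coeff a2 = (\<lambda>n. dlog_coeff (dlog_coeff a1) n
      + (dlog_coeff (geometric_coeff \<mu> a1) n + dlog_coeff (geometric_coeff (cnj \<mu>) a1) n))"
    unfolding a2_def by (simp only: dlog_coeff_add fun_eq_iff) simp
  \<comment> \<open>For \<eta> equal to \<mu> or \<open>cnj \<mu>\<close>, letting \<zeta> run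
    through 1, \<eta> and \<open>cnj \<eta>\<close> makes the second argument
    \<open>cnj \<eta>\<close>, 1 and \<open>(cnj \<eta>)\<^sup>2\<close>, with weights 2, -1 and
    -1.\<close>
  moreover have "\<dots> sums (2 * Li [3] [1] + - 1 * (Li [3] [\<mu>] + Li [3] [cnj \<mu>])
      + ((2 * Li [2, 1] [\<mu>, 1 * inverse \<mu>] + - 1 * (Li [2, 1] [\<mu>, \<mu> * inverse \<mu>] + Li [2, 1] [\<mu>, cnj \<mu> * inverse \<mu>]))
       + (2 * Li [2, 1] [cnj \<mu>, 1 * inverse (cnj \<mu>)] + - 1 * (Li [2, 1] [cnj \<mu>, \<mu> * inverse (cnj \<mu>)]
           + Li [2, 1] [cnj \<mu>, cnj \<mu> * inverse (cnj \<mu>)]))))"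
    unfolding dd dg by (intro sums_add sums_mult LiP LiPP) (simp_all add: norm_\<mu>)
  moreover have "\<mu> * cnj \<mu> = 1"
    by (rule \<mu>_cnj(1)[OF norm_\<mu> \<mu>_ne_1 refl])
  ultimately have S2: "suminf (dlog_coeff a2) = ?S2"
    by (simp add: sums_iff zeta inv power2_eq_square mult.commute[of "cnj \<mu>" \<mu>])
  have "composition []" by (simp add: composition_def)
  from series[OF _ this, of 1 a1] series[OF _ this, of 2 a2] a1 a2 eq1 eq2
  have *: "(\<lambda>n. complex_of_real (multiple_harmonic_sum n [] / real (Suc n) ^ 1
        * (1 - cos \<theta>) ^ Suc n * F (Suc n))) sums ?S1"
    "?S1 \<in> CMZV N (sum_list [] + 1 + 1)"
    "(\<lambda>n. complex_of_real (multiple_harmonic_sum n [] / real (Suc n) ^ 2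
        * (1 - cos \<theta>) ^ Suc n * F (Suc n))) sums ?S2"
    "?S2 \<in> CMZV N (sum_list [] + 2 + 1)"
    unfolding S1 S2 by (simp_all del: polylog_coeff.simps)
  have shape: "multiple_harmonic_sum n [] / real (Suc n) ^ l * (1 - cos \<theta>) ^ Suc n * F (Suc n)
      = (1 - cos \<theta>) ^ Suc n * F (Suc n) / real (Suc n) ^ l" for n l
    by (simp add: multiple_harmonic_sum_Nil)
  have weights: "sum_list [] + 1 + 1 = (2::nat)" "sum_list [] + 2 + 1 = (3::nat)" by simp_all
  note *[unfolded shape weights, unfolded power_one_right]
  with general show ?thesis by blast
qed

end
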